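(* Let $k$ be a countable field and let $A$ be a countably generated associative unital $k$-algebra (with $1\neq 0$). Then there exist a simple associative unital $k$-algebra $\mathcal{A}$ that is generated as a $k$-algebra by two elements, and an injective homomorphism of unital $k$-algebras $A\to\mathcal{A}$.
   Context: All associative algebras here contain a unit. "Countable" and "countably generated" mean: at most countable, respectively generated by an at most countable set. An associative unital algebra is simple if it is nonzero and its only two-sided ideals are $0$ and itself. *)

theory Defs
  imports "HOL-Algebra.Algebra" "HOL-Library.Countable_Set"
begin

text \<open>
  The library locale \<open>algebra\<close> requires multiplication to be commutative. The locale below
  drops this, and therefore has to state compatibility with scalars on both sides.
\<close>

locale assoc_algebra = module R M + ring M
  for R :: "('k, 'm) ring_scheme" (structure) and M :: "('k, 'a, 'n) module_scheme" (structure) +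
  assumes smult_mult_left:
      "\<lbrakk>c \<in> carrier R; x \<in> carrier M; y \<in> carrier M\<rbrakk> \<Longrightarrow>
      (c \<odot>\<^bsub>M\<^esub> x) \<otimes>\<^bsub>M\<^esub> y = c \<odot>\<^bsub>M\<^esub> (x \<otimes>\<^bsub>M\<^esub> y)"
    and smult_mult_right:
      "\<lbrakk>c \<in> carrier R; x \<in> carrier M; y \<in> carrier M\<rbrakk> \<Longrightarrow>
      x \<otimes>\<^bsub>M\<^esub> (c \<odot>\<^bsub>M\<^esub> y) = c \<odot>\<^bsub>M\<^esub> (x \<otimes>\<^bsub>M\<^esub> y)"

text \<open>Subalgebras contain the unit of \<open>M\<close>, since \<open>subring\<close> does. (The library locale
  \<open>subalgebra\<close> is a different notion: there the scalars are a subset of the ring.)\<close>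

definition unital_subalgebra ::
    "'a set \<Rightarrow> ('k, 'm) ring_scheme \<Rightarrow> ('k, 'a, 'n) module_scheme \<Rightarrow> bool" where
  "unital_subalgebra H R M \<longleftrightarrow> subring H M \<and> submodule H R M"

definition algebra_generated ::
    "('k, 'm) ring_scheme \<Rightarrow> ('k, 'a, 'n) module_scheme \<Rightarrow> 'a set \<Rightarrow> 'a set" where
  "algebra_generated R M S = \<Inter>{H. unital_subalgebra H R M \<and> S \<subseteq> H}"

definition countably_generated_algebra ::
    "('k, 'm) ring_scheme \<Rightarrow> ('k, 'a, 'n) module_scheme \<Rightarrow> bool" where
  "countably_generated_algebra R M \<longleftrightarrow>
     (\<exists>S. S \<subseteq> carrier M \<and> countable S \<and> algebra_generated R M S = carrier M)"

text \<open>The library's \<open>ideal\<close> is two-sided. Over a unital algebra every ring ideal is closed under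
  scalars, as \<open>c \<odot> x = (c \<odot> \<one>) \<otimes> x\<close>, so ring ideals and algebra ideals coincide.\<close>

definition simple_algebra ::
    "('k, 'm) ring_scheme \<Rightarrow> ('k, 'a, 'n) module_scheme \<Rightarrow> bool" where
  "simple_algebra R M \<longleftrightarrow> assoc_algebra R M \<and> carrier M \<noteq> {\<zero>\<^bsub>M\<^esub>} \<and>
     (\<forall>I. ideal I M \<longrightarrow> I = {\<zero>\<^bsub>M\<^esub>} \<or> I = carrier M)"

definition algebra_hom ::
    "('k, 'm) ring_scheme \<Rightarrow> ('k, 'a, 'n) module_scheme \<Rightarrow> ('k, 'b, 'l) module_scheme \<Rightarrow>
     ('a \<Rightarrow> 'b) set" where
  "algebra_hom R M N = {h \<in> ring_hom M N.
     \<forall>c\<in>carrier R. \<forall>x\<in>carrier M. h (c \<odot>\<^bsub>M\<^esub> x) = c \<odot>\<^bsub>N\<^esub> h x}"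

end

theory Submission
  imports Defs
begin

text \<open>
  It suffices to find a countable algebra generated by two elements that contains \<open>A\<close> and in which
  every nonzero \<open>a \<in> A\<close> satisfies \<open>y a z = 1\<close> for some \<open>y, z\<close>: a proper ideal then meets \<open>A\<close>
  trivially, so the quotient by any maximal ideal is simple and still contains \<open>A\<close>.

  Let \<open>A\<close> act on the scalar functions \<open>F\<close> of sequences \<open>b\<close> in \<open>A\<close> that are multilinear in the
  entries of \<open>b\<close>, by \<open>(a F)(b\<^sub>0, b\<^sub>1, \<dots>) = F(b\<^sub>0 a, b\<^sub>1, \<dots>)\<close>. For a linear functional \<open>\<phi>\<close> with
  \<open>\<phi> a = 1\<close>, the operators \<open>(z F)(b\<^sub>0, b\<^sub>1, \<dots>) = \<phi>(b\<^sub>0) F(b\<^sub>1, \<dots>)\<close> and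
  \<open>(y F)(b\<^sub>0, b\<^sub>1, \<dots>) = F(1, b\<^sub>0, \<dots>)\<close> satisfy \<open>y a z = 1\<close>. On sequences of such functions, any
  countable family of operators lies in a subalgebra generated by two operators, as in Sierpinski's
  theorem on countable sets of maps.
\<close>

section \<open>Maximal ideals and linear functionals\<close>

lemma assoc_algebraI:
  assumes "module K M" "ring M"
    and "\<And>c x y. \<lbrakk>c \<in> carrier K; x \<in> carrier M; y \<in> carrier M\<rbrakk> \<Longrightarrow>
      (c \<odot>\<^bsub>M\<^esub> x) \<otimes>\<^bsub>M\<^esub> y = c \<odot>\<^bsub>M\<^esub> (x \<otimes>\<^bsub>M\<^esub> y)"
    and "\<And>c x y. \<lbrakk>c \<in> carrier K; x \<in> carrier M; y \<in> carrier M\<rbrakk> \<Longrightarrow>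
      x \<otimes>\<^bsub>M\<^esub> (c \<odot>\<^bsub>M\<^esub> y) = c \<odot>\<^bsub>M\<^esub> (x \<otimes>\<^bsub>M\<^esub> y)"
  shows "assoc_algebra K M"
  by (intro assoc_algebra.intro assoc_algebra_axioms.intro assms)

lemma (in module) minus_one_smult:
  assumes "x \<in> carrier M"
  shows "(\<ominus>\<^bsub>R\<^esub> \<one>\<^bsub>R\<^esub>) \<odot>\<^bsub>M\<^esub> x = \<ominus>\<^bsub>M\<^esub> x"
  using assms by (simp add: smult_l_minus)

text \<open>One binary condition carries all closure properties: \<open>x + (-1) x\<close> is zero,
  and the others are special cases. This is the shape that \<open>maximal_closed_set\<close>
  accepts.\<close>

lemma (in module) submoduleI':
  assumes sub: "H \<subseteq> carrier M" and ne: "H \<noteq> {}"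
    and cl: "\<And>c x y. \<lbrakk>c \<in> carrier R; x \<in> H; y \<in> H\<rbrakk> \<Longrightarrow> x \<oplus>\<^bsub>M\<^esub> c \<odot>\<^bsub>M\<^esub> y \<in> H"
  shows "submodule H R M"
proof -
  obtain x where x: "x \<in> H" using ne by blast
  have z: "\<zero>\<^bsub>M\<^esub> \<in> H"
    using cl[of "\<ominus>\<^bsub>R\<^esub> \<one>\<^bsub>R\<^esub>" x x] x sub by (auto simp: minus_one_smult M.r_neg)
  have s: "c \<odot>\<^bsub>M\<^esub> y \<in> H" if "c \<in> carrier R" "y \<in> H" for c y
    using cl[of c "\<zero>\<^bsub>M\<^esub>" y] that z sub by auto
  have n: "\<ominus>\<^bsub>M\<^esub> y \<in> H" if "y \<in> H" for y
    using s[of "\<ominus>\<^bsub>R\<^esub> \<one>\<^bsub>R\<^esub>" y] that sub by (auto simp: minus_one_smult)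
  have p: "y \<oplus>\<^bsub>M\<^esub> v \<in> H" if "y \<in> H" "v \<in> H" for y v
    using cl[of "\<one>\<^bsub>R\<^esub>" y v] that sub by auto
  show ?thesis by (rule submoduleI) (use sub z s n p in auto)
qed

text \<open>By Zorn's lemma: two elements of the union of a chain lie in a common member, so the
  union is closed again. Here \<open>g x y\<close> collects what \<open>x\<close> and
  \<open>y\<close> force into the set; the lemma serves both two-sided ideals and subspaces.\<close>

lemma maximal_closed_set:
  fixes g :: "'a \<Rightarrow> 'a \<Rightarrow> 'a set" and C :: "'a set"
  assumes cl_def: "\<And>S. cl S \<longleftrightarrow> S \<noteq> {} \<and> S \<subseteq> C \<and> (\<forall>x\<in>S. \<forall>y\<in>S. g x y \<subseteq> S)"
    and "cl S" "z \<notin> S"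
  obtains T where "cl T" "z \<notin> T" "\<And>U. \<lbrakk>cl U; T \<subseteq> U; z \<notin> U\<rbrakk> \<Longrightarrow> U = T"
proof -
  let ?A = "{T. cl T \<and> z \<notin> T}"
  have "\<exists>T\<in>?A. \<forall>U\<in>?A. T \<subseteq> U \<longrightarrow> U = T"
  proof (rule subset_Zorn_nonempty)
    show "?A \<noteq> {}" using assms by blast
    fix \<C> assume ne: "\<C> \<noteq> {}" and ch: "subset.chain ?A \<C>"
    have mem: "\<And>P. P \<in> \<C> \<Longrightarrow> cl P \<and> z \<notin> P"
      using ch by (auto simp: subset.chain_def)
    have "g x y \<subseteq> \<Union>\<C>" if xy: "x \<in> \<Union>\<C>" "y \<in> \<Union>\<C>" for x y
    proof -
      obtain P Q where PQ: "P \<in> \<C>" "x \<in> P" "Q \<in> \<C>" "y \<in> Q" using xy by blast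
      then have "P \<subseteq> Q \<or> Q \<subseteq> P" using ch by (auto simp: subset.chain_def)
      then obtain N where "N \<in> \<C>" "x \<in> N" "y \<in> N" using PQ by blast
      then show ?thesis using mem[of N] unfolding cl_def by blast
    qed
    then show "\<Union>\<C> \<in> ?A"
      using mem ne unfolding cl_def by blast
  qed
  then show ?thesis using that by blast
qed

text \<open>The counterpart of \<open>submoduleI'\<close> for two-sided ideals; taking
  \<open>y = x\<close>, \<open>r = -1\<close> and \<open>s = 1\<close> produces zero.\<close>

lemma (in ring) idealI':
  assumes sub: "I \<subseteq> carrier R" and ne: "I \<noteq> {}"
    and cl: "\<And>x y r s. \<lbrakk>x \<in> I; y \<in> I; r \<in> carrier R; s \<in> carrier R\<rbrakk> \<Longrightarrow> x \<oplus> r \<otimes> y \<otimes> s \<in> I"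
  shows "ideal I R"
proof -
  obtain x where x: "x \<in> I" using ne by blast
  have z: "\<zero> \<in> I"
    using cl[of x x "\<ominus> \<one>" \<one>] x sub by (auto simp: l_minus r_neg)
  have s: "r \<otimes> y \<otimes> t \<in> I" if "r \<in> carrier R" "t \<in> carrier R" "y \<in> I" for r y t
    using cl[of \<zero> y r t] that z sub by auto
  have n: "\<ominus> y \<in> I" if "y \<in> I" for y
    using s[of "\<ominus> \<one>" \<one> y] that sub by (auto simp: l_minus)
  have p: "y \<oplus> v \<in> I" if "y \<in> I" "v \<in> I" for y v
    using cl[of y v \<one> \<one>] that sub by auto
  show ?thesis
  proof (rule idealI)
    show "ring R" by (rule ring_axioms)
    show "subgroup I (add_monoid R)"
      by (rule add.subgroupI) (use sub ne n p in \<open>auto simp: a_inv_def\<close>)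
  next
    fix a x assume "a \<in> I" "x \<in> carrier R"
    then show "x \<otimes> a \<in> I" "a \<otimes> x \<in> I"
      using s[of x \<one> a] s[of \<one> x a] sub by auto
  qed
qed

text \<open>An ideal is proper exactly when it misses 1, so an ideal that is maximal among those
  missing 1 is a maximal ideal.\<close>

lemma (in ring) exists_maximalideal:
  assumes "\<one> \<noteq> \<zero>"
  obtains I where "maximalideal I R"
proof -
  define g where "g x y = {x \<oplus> r \<otimes> y \<otimes> s |r s. r \<in> carrier R \<and> s \<in> carrier R}" for x y
  have ideal: "ideal I R \<longleftrightarrow> I \<noteq> {} \<and> I \<subseteq> carrier R \<and> (\<forall>x\<in>I. \<forall>y\<in>I. g x y \<subseteq> I)" for I
  proof
    assume "ideal I R"
    then interpret I: ideal I R .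
    have "I \<subseteq> carrier R" "\<zero> \<in> I" using I.a_subset I.zero_closed by auto
    moreover have "x \<oplus> r \<otimes> y \<otimes> s \<in> I"
      if "x \<in> I" "y \<in> I" "r \<in> carrier R" "s \<in> carrier R" for x y r s
      using that by (intro I.a_closed I.I_r_closed I.I_l_closed)
    ultimately show "I \<noteq> {} \<and> I \<subseteq> carrier R \<and> (\<forall>x\<in>I. \<forall>y\<in>I. g x y \<subseteq> I)"
      unfolding g_def by blast
  next
    assume "I \<noteq> {} \<and> I \<subseteq> carrier R \<and> (\<forall>x\<in>I. \<forall>y\<in>I. g x y \<subseteq> I)"
    then show "ideal I R" by (intro idealI') (unfold g_def, blast+)
  qed
  obtain I where I: "ideal I R" "\<one> \<notin> I"
    and max: "\<And>J. \<lbrakk>ideal J R; I \<subseteq> J; \<one> \<notin> J\<rbrakk> \<Longrightarrow> J = I"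
    by (rule maximal_closed_set[of "\<lambda>I. ideal I R", OF ideal zeroideal, of \<one>])
      (use assms in auto)
  have "maximalideal I R"
  proof (rule maximalidealI)
    show "carrier R \<noteq> I" using I by auto
    show "J = I \<or> J = carrier R" if "ideal J R" "I \<subseteq> J" for J
      using max[OF that] ideal.one_imp_carrier[OF that(1)] by blast
  qed (rule I)
  then show ?thesis using that by blast
qed

text \<open>A subspace \<open>H\<close> that is maximal among those avoiding \<open>a\<close> is a
  complement of the line through \<open>a\<close>; the functional reads off the coordinate along
  \<open>a\<close>.\<close>

lemma exists_linear_functional:
  fixes K (structure) and M (structure)
  assumes "field K" "module K M" and a: "a \<in> carrier M" "a \<noteq> \<zero>\<^bsub>M\<^esub>"
  obtains \<phi> where "\<phi> \<in> carrier M \<rightarrow> carrier K" "\<phi> a = \<one>\<^bsub>K\<^esub>"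
    "\<And>x y. \<lbrakk>x \<in> carrier M; y \<in> carrier M\<rbrakk> \<Longrightarrow> \<phi> (x \<oplus>\<^bsub>M\<^esub> y) = \<phi> x \<oplus>\<^bsub>K\<^esub> \<phi> y"
    "\<And>c x. \<lbrakk>c \<in> carrier K; x \<in> carrier M\<rbrakk> \<Longrightarrow> \<phi> (c \<odot>\<^bsub>M\<^esub> x) = c \<otimes>\<^bsub>K\<^esub> \<phi> x"
proof -
  interpret K: field K by fact
  interpret module K M by fact
  define g where "g x y = {x \<oplus>\<^bsub>M\<^esub> c \<odot>\<^bsub>M\<^esub> y |c. c \<in> carrier K}" for x y
  have sm: "submodule H K M \<longleftrightarrow> H \<noteq> {} \<and> H \<subseteq> carrier M \<and> (\<forall>x\<in>H. \<forall>y\<in>H. g x y \<subseteq> H)" for H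
  proof
    assume "submodule H K M"
    from submoduleE[OF this]
    show "H \<noteq> {} \<and> H \<subseteq> carrier M \<and> (\<forall>x\<in>H. \<forall>y\<in>H. g x y \<subseteq> H)"
      by (auto simp: g_def)
  next
    assume "H \<noteq> {} \<and> H \<subseteq> carrier M \<and> (\<forall>x\<in>H. \<forall>y\<in>H. g x y \<subseteq> H)"
    then show "submodule H K M" by (intro submoduleI') (unfold g_def, blast+)
  qed
  have "submodule {\<zero>\<^bsub>M\<^esub>} K M" by (rule submoduleI') auto
  then obtain H where H: "submodule H K M" "a \<notin> H"
    and max: "\<And>U. \<lbrakk>submodule U K M; H \<subseteq> U; a \<notin> U\<rbrakk> \<Longrightarrow> U = H"
    by (rule maximal_closed_set[of "\<lambda>H. submodule H K M", OF sm, of "{\<zero>\<^bsub>M\<^esub>}" a])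
      (use a in auto)
  have Hsub: "H \<subseteq> carrier M" and Hne: "H \<noteq> {}"
    and Hs: "\<And>c b. \<lbrakk>c \<in> carrier K; b \<in> H\<rbrakk> \<Longrightarrow> c \<odot>\<^bsub>M\<^esub> b \<in> H"
    and Ha: "\<And>b b'. \<lbrakk>b \<in> H; b' \<in> H\<rbrakk> \<Longrightarrow> b \<oplus>\<^bsub>M\<^esub> b' \<in> H"
    and Hn: "\<And>b. b \<in> H \<Longrightarrow> \<ominus>\<^bsub>M\<^esub> b \<in> H"
    using submoduleE[OF H(1)] by auto
  have zeroH: "\<zero>\<^bsub>M\<^esub> \<in> H" using Hne Ha Hn Hsub by (metis M.r_neg all_not_in_conv in_mono)
  note ac = M.a_assoc M.a_comm M.a_lcomm
  have span: "\<exists>c\<in>carrier K. \<exists>h\<in>H. w = h \<oplus>\<^bsub>M\<^esub> c \<odot>\<^bsub>M\<^esub> a" if w: "w \<in> carrier M" for w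
  proof (cases "w \<in> H")
    case True
    then show ?thesis using a Hsub by (intro bexI[of _ "\<zero>\<^bsub>K\<^esub>"] bexI[of _ w]) auto
  next
    case False
    \<comment> \<open>The subspace spanned by \<open>H\<close> and \<open>w\<close> is strictly
      larger than \<open>H\<close>, so maximality forces it to contain \<open>a\<close>. The
      resulting relation is then solved for \<open>w\<close>.\<close>
    let ?U = "{h \<oplus>\<^bsub>M\<^esub> c \<odot>\<^bsub>M\<^esub> w |h c. h \<in> H \<and> c \<in> carrier K}"
    have "submodule ?U K M"
    proof (rule submoduleI')
      show "?U \<subseteq> carrier M" using w Hsub by auto
      show "?U \<noteq> {}" using Hne K.zero_closed by blast
      fix c x y assume c: "c \<in> carrier K" and "x \<in> ?U" "y \<in> ?U"
      then obtain h d h' d' where e: "x = h \<oplus>\<^bsub>M\<^esub> d \<odot>\<^bsub>M\<^esub> w" "h \<in> H" "d \<in> carrier K"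
        "y = h' \<oplus>\<^bsub>M\<^esub> d' \<odot>\<^bsub>M\<^esub> w" "h' \<in> H" "d' \<in> carrier K" by blast
      have hc: "h \<in> carrier M" "h' \<in> carrier M" using e Hsub by auto
      have "x \<oplus>\<^bsub>M\<^esub> c \<odot>\<^bsub>M\<^esub> y = (h \<oplus>\<^bsub>M\<^esub> c \<odot>\<^bsub>M\<^esub> h') \<oplus>\<^bsub>M\<^esub> (d \<oplus>\<^bsub>K\<^esub> c \<otimes>\<^bsub>K\<^esub> d') \<odot>\<^bsub>M\<^esub> w"
        using e w c hc by (simp add: smult_r_distr smult_l_distr smult_assoc1 ac)
      moreover have "h \<oplus>\<^bsub>M\<^esub> c \<odot>\<^bsub>M\<^esub> h' \<in> H" using e c Hs Ha by auto
      ultimately show "x \<oplus>\<^bsub>M\<^esub> c \<odot>\<^bsub>M\<^esub> y \<in> ?U" using e c by blast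
    qed
    moreover have "H \<subseteq> ?U"
    proof
      fix h assume "h \<in> H"
      moreover have "h = h \<oplus>\<^bsub>M\<^esub> \<zero>\<^bsub>K\<^esub> \<odot>\<^bsub>M\<^esub> w" using \<open>h \<in> H\<close> w Hsub by auto
      ultimately show "h \<in> ?U" by blast
    qed
    moreover have "w \<in> ?U"
    proof -
      have "w = \<zero>\<^bsub>M\<^esub> \<oplus>\<^bsub>M\<^esub> \<one>\<^bsub>K\<^esub> \<odot>\<^bsub>M\<^esub> w" using w by simp
      then show ?thesis using zeroH by blast
    qed
    ultimately have "a \<in> ?U" using max[of ?U] False by blast
    then obtain h c where hc: "a = h \<oplus>\<^bsub>M\<^esub> c \<odot>\<^bsub>M\<^esub> w" "h \<in> H" "c \<in> carrier K" by blast
    have h: "h \<in> carrier M" using hc Hsub by auto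
    \<comment> \<open>With coefficient zero, \<open>a\<close> would equal \<open>h\<close>, an
      element of \<open>H\<close>.\<close>
    have "c \<noteq> \<zero>\<^bsub>K\<^esub>" using hc w h H(2) by auto
    then have c: "inv\<^bsub>K\<^esub> c \<in> carrier K" "inv\<^bsub>K\<^esub> c \<otimes>\<^bsub>K\<^esub> c = \<one>\<^bsub>K\<^esub>"
      using hc(3) K.field_Units by auto
    have "inv\<^bsub>K\<^esub> c \<odot>\<^bsub>M\<^esub> a = inv\<^bsub>K\<^esub> c \<odot>\<^bsub>M\<^esub> h \<oplus>\<^bsub>M\<^esub> w"
      using hc c h w by (simp add: smult_r_distr smult_assoc1[symmetric])
    then have "w = \<ominus>\<^bsub>M\<^esub> (inv\<^bsub>K\<^esub> c \<odot>\<^bsub>M\<^esub> h) \<oplus>\<^bsub>M\<^esub> inv\<^bsub>K\<^esub> c \<odot>\<^bsub>M\<^esub> a"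
      using c h w by (simp add: M.r_neg1)
    moreover have "\<ominus>\<^bsub>M\<^esub> (inv\<^bsub>K\<^esub> c \<odot>\<^bsub>M\<^esub> h) \<in> H" using Hn Hs hc c by auto
    ultimately show ?thesis using c by blast
  qed
  \<comment> \<open>Two different coefficients would place a nonzero multiple of \<open>a\<close>,
    hence \<open>a\<close> itself, in \<open>H\<close>.\<close>
  have uniq: "c = c'" if e: "h \<oplus>\<^bsub>M\<^esub> c \<odot>\<^bsub>M\<^esub> a = h' \<oplus>\<^bsub>M\<^esub> c' \<odot>\<^bsub>M\<^esub> a"
    and mem: "h \<in> H" "h' \<in> H" "c \<in> carrier K" "c' \<in> carrier K" for c c' h h'
  proof (rule ccontr)
    assume ne: "c \<noteq> c'"
    have hc: "h \<in> carrier M" "h' \<in> carrier M" using mem Hsub by auto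
    have "c \<ominus>\<^bsub>K\<^esub> c' \<in> Units K" using ne mem by (simp add: K.field_Units)
    then have u: "inv\<^bsub>K\<^esub> (c \<ominus>\<^bsub>K\<^esub> c') \<in> carrier K"
      "inv\<^bsub>K\<^esub> (c \<ominus>\<^bsub>K\<^esub> c') \<otimes>\<^bsub>K\<^esub> (c \<ominus>\<^bsub>K\<^esub> c') = \<one>\<^bsub>K\<^esub>" by auto
    have "(c \<ominus>\<^bsub>K\<^esub> c') \<odot>\<^bsub>M\<^esub> a = \<ominus>\<^bsub>M\<^esub> h \<oplus>\<^bsub>M\<^esub> ((h \<oplus>\<^bsub>M\<^esub> c \<odot>\<^bsub>M\<^esub> a) \<oplus>\<^bsub>M\<^esub> \<ominus>\<^bsub>M\<^esub> (c' \<odot>\<^bsub>M\<^esub> a))"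
      using mem a hc
      by (simp add: K.minus_eq smult_l_distr smult_l_minus M.a_assoc M.r_neg1)
    also have "\<dots> = \<ominus>\<^bsub>M\<^esub> h \<oplus>\<^bsub>M\<^esub> h'"
      unfolding e using mem a hc by (simp add: M.a_assoc M.r_neg)
    finally have "(c \<ominus>\<^bsub>K\<^esub> c') \<odot>\<^bsub>M\<^esub> a \<in> H" using mem Hn Ha by auto
    then have "inv\<^bsub>K\<^esub> (c \<ominus>\<^bsub>K\<^esub> c') \<odot>\<^bsub>M\<^esub> ((c \<ominus>\<^bsub>K\<^esub> c') \<odot>\<^bsub>M\<^esub> a) \<in> H" using u Hs by auto
    then show False
      using H(2) a mem u by (simp add: smult_assoc1[symmetric])
  qed
  define \<phi> where "\<phi> w = (THE c. c \<in> carrier K \<and> (\<exists>h\<in>H. w = h \<oplus>\<^bsub>M\<^esub> c \<odot>\<^bsub>M\<^esub> a))" for w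
  have phi: "\<phi> (h \<oplus>\<^bsub>M\<^esub> c \<odot>\<^bsub>M\<^esub> a) = c" if "h \<in> H" "c \<in> carrier K" for h c
    unfolding \<phi>_def using that uniq by (intro the_equality) blast+
  show ?thesis
  proof (rule that[of \<phi>])
    show "\<phi> \<in> carrier M \<rightarrow> carrier K" using span phi by fastforce
    show "\<phi> a = \<one>\<^bsub>K\<^esub>" using phi[OF zeroH K.one_closed] a by simp
  next
    fix x y assume xy: "x \<in> carrier M" "y \<in> carrier M"
    obtain c h where e1: "c \<in> carrier K" "h \<in> H" "x = h \<oplus>\<^bsub>M\<^esub> c \<odot>\<^bsub>M\<^esub> a"
      using span[OF xy(1)] by blast
    obtain d k where e2: "d \<in> carrier K" "k \<in> H" "y = k \<oplus>\<^bsub>M\<^esub> d \<odot>\<^bsub>M\<^esub> a"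
      using span[OF xy(2)] by blast
    note e = e1 e2
    then have hc: "h \<in> carrier M" "k \<in> carrier M" using Hsub by auto
    have "x \<oplus>\<^bsub>M\<^esub> y = (h \<oplus>\<^bsub>M\<^esub> k) \<oplus>\<^bsub>M\<^esub> (c \<oplus>\<^bsub>K\<^esub> d) \<odot>\<^bsub>M\<^esub> a"
      using e hc a by (simp add: smult_l_distr ac)
    then show "\<phi> (x \<oplus>\<^bsub>M\<^esub> y) = \<phi> x \<oplus>\<^bsub>K\<^esub> \<phi> y" using e Ha by (simp add: phi)
  next
    fix c x assume c: "c \<in> carrier K" and "x \<in> carrier M"
    then obtain h d where e: "h \<in> H" "d \<in> carrier K" "x = h \<oplus>\<^bsub>M\<^esub> d \<odot>\<^bsub>M\<^esub> a"
      using span[of x] by blast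
    then have hc: "h \<in> carrier M" using Hsub by auto
    have "c \<odot>\<^bsub>M\<^esub> x = c \<odot>\<^bsub>M\<^esub> h \<oplus>\<^bsub>M\<^esub> (c \<otimes>\<^bsub>K\<^esub> d) \<odot>\<^bsub>M\<^esub> a"
      using e hc a c by (simp add: smult_r_distr smult_assoc1)
    then show "\<phi> (c \<odot>\<^bsub>M\<^esub> x) = c \<otimes>\<^bsub>K\<^esub> \<phi> x" using e c Hs by (simp add: phi)
  qed
qed

section \<open>Subalgebras and countable quotients\<close>

lemma (in assoc_algebra) unital_subalgebraI:
  assumes "H \<subseteq> carrier M" "\<one>\<^bsub>M\<^esub> \<in> H"
    and "\<And>x y. \<lbrakk>x \<in> H; y \<in> H\<rbrakk> \<Longrightarrow> x \<oplus>\<^bsub>M\<^esub> y \<in> H"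
    and "\<And>x y. \<lbrakk>x \<in> H; y \<in> H\<rbrakk> \<Longrightarrow> x \<otimes>\<^bsub>M\<^esub> y \<in> H"
    and "\<And>c x. \<lbrakk>c \<in> carrier R; x \<in> H\<rbrakk> \<Longrightarrow> c \<odot>\<^bsub>M\<^esub> x \<in> H"
  shows "unital_subalgebra H R M"
proof -
  have n: "\<ominus>\<^bsub>M\<^esub> x \<in> H" if "x \<in> H" for x
    using assms(5)[of "\<ominus>\<^bsub>R\<^esub> \<one>\<^bsub>R\<^esub>" x] assms(1) that by (auto simp: minus_one_smult)
  have s: "submodule H R M"
    by (rule submoduleI') (use assms in auto)
  have r: "subring H M"
    by (rule ring.subringI) (use assms n ring_axioms in auto)
  show ?thesis using s r by (simp add: unital_subalgebra_def)
qed

lemma (in assoc_algebra) unital_subalgebraE: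
  assumes "unital_subalgebra H R M"
  shows "H \<subseteq> carrier M" "\<one>\<^bsub>M\<^esub> \<in> H" "\<zero>\<^bsub>M\<^esub> \<in> H"
    and "\<And>x y. \<lbrakk>x \<in> H; y \<in> H\<rbrakk> \<Longrightarrow> x \<oplus>\<^bsub>M\<^esub> y \<in> H"
    and "\<And>x y. \<lbrakk>x \<in> H; y \<in> H\<rbrakk> \<Longrightarrow> x \<otimes>\<^bsub>M\<^esub> y \<in> H"
    and "\<And>c x. \<lbrakk>c \<in> carrier R; x \<in> H\<rbrakk> \<Longrightarrow> c \<odot>\<^bsub>M\<^esub> x \<in> H"
proof -
  have r: "subring H M" and s: "submodule H R M"
    using assms by (simp_all add: unital_subalgebra_def)
  show "H \<subseteq> carrier M" "\<one>\<^bsub>M\<^esub> \<in> H" "\<zero>\<^bsub>M\<^esub> \<in> H"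
    using subringE(1-3)[OF r] by auto
  show "x \<oplus>\<^bsub>M\<^esub> y \<in> H" "x \<otimes>\<^bsub>M\<^esub> y \<in> H" if "x \<in> H" "y \<in> H" for x y
    using subringE(6,7)[OF r that] by auto
  show "c \<odot>\<^bsub>M\<^esub> x \<in> H" if "c \<in> carrier R" "x \<in> H" for c x
    using submoduleE(4)[OF s that] .
qed

lemma (in assoc_algebra) unital_subalgebra_is_algebra:
  assumes H: "unital_subalgebra H R M"
  shows "assoc_algebra R (M\<lparr>carrier := H\<rparr>)"
proof (rule assoc_algebraI)
  show "module R (M\<lparr>carrier := H\<rparr>)"
    using H submodule.submodule_is_module module_axioms by (auto simp: unital_subalgebra_def)
  show "ring (M\<lparr>carrier := H\<rparr>)"
    using H ring.subring_is_ring ring_axioms by (auto simp: unital_subalgebra_def)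
qed (use unital_subalgebraE(1)[OF H] in \<open>auto simp: subset_iff smult_mult_left smult_mult_right\<close>)

lemma (in assoc_algebra) unital_subalgebra_trans:
  assumes "unital_subalgebra H R M" "unital_subalgebra L R (M\<lparr>carrier := H\<rparr>)"
  shows "unital_subalgebra L R M"
proof -
  interpret H: assoc_algebra R "M\<lparr>carrier := H\<rparr>"
    using assms(1) by (rule unital_subalgebra_is_algebra)
  show ?thesis
    using unital_subalgebraE(1)[OF assms(1)] H.unital_subalgebraE[OF assms(2)]
    by (intro unital_subalgebraI) auto
qed

lemma (in assoc_algebra) carrier_unital_subalgebra: "unital_subalgebra (carrier M) R M"
  by (rule unital_subalgebraI) auto

lemma (in assoc_algebra) algebra_generated_subalgebra:
  assumes "S \<subseteq> carrier M"
  shows "unital_subalgebra (algebra_generated R M S) R M"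
proof (rule unital_subalgebraI)
  show "algebra_generated R M S \<subseteq> carrier M"
    unfolding algebra_generated_def using assms carrier_unital_subalgebra by blast
qed (auto simp: algebra_generated_def unital_subalgebraE)

lemma algebra_generated_incl: "S \<subseteq> algebra_generated K M S"
  by (auto simp: algebra_generated_def)

lemma algebra_generated_least:
  "\<lbrakk>unital_subalgebra H K M; S \<subseteq> H\<rbrakk> \<Longrightarrow> algebra_generated K M S \<subseteq> H"
  by (auto simp: algebra_generated_def)

text \<open>The subalgebra is exhausted by countably many stages, each adding the images of
  countably many tuples to a countable set.\<close>

lemma (in assoc_algebra) countable_algebra_generated:
  assumes K: "countable (carrier R)" and S: "S \<subseteq> carrier M" "countable S"
  shows "countable (algebra_generated R M S)"
proof -
  \<comment> \<open>One operation covers all three: \<open>c = 1\<close> and \<open>z = 1\<close>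
    give sums, \<open>c = 0\<close> gives products, \<open>y = z = 0\<close> gives scalar
    multiples.\<close>
  define f where "f = (\<lambda>(c, x, y, z). (c \<odot>\<^bsub>M\<^esub> x) \<oplus>\<^bsub>M\<^esub> (y \<otimes>\<^bsub>M\<^esub> z))"
  define T where "T = rec_nat (S \<union> {\<zero>\<^bsub>M\<^esub>, \<one>\<^bsub>M\<^esub>}) (\<lambda>_ U. U \<union> f ` (carrier R \<times> U \<times> U \<times> U))"
  have T0: "T 0 = S \<union> {\<zero>\<^bsub>M\<^esub>, \<one>\<^bsub>M\<^esub>}"
    and TS: "T (Suc n) = T n \<union> f ` (carrier R \<times> T n \<times> T n \<times> T n)" for n
    by (simp_all add: T_def)
  have cnt: "countable (T n)" for n
    by (induction n) (use K S in \<open>auto simp: T0 TS\<close>)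
  have sub: "T n \<subseteq> carrier M" for n
  proof (induction n)
    case 0
    then show ?case using S by (auto simp: T0)
  next
    case (Suc n)
    then show ?case by (auto simp: TS f_def subset_iff)
  qed
  have mono: "T m \<subseteq> T n" if "m \<le> n" for m n
    using that by (rule lift_Suc_mono_le[rotated]) (auto simp: TS)
  have step: "(c \<odot>\<^bsub>M\<^esub> x) \<oplus>\<^bsub>M\<^esub> (y \<otimes>\<^bsub>M\<^esub> z) \<in> \<Union> (range T)"
    if c: "c \<in> carrier R" and xyz: "x \<in> \<Union> (range T)" "y \<in> \<Union> (range T)" "z \<in> \<Union> (range T)"
    for c x y z
  proof -
    obtain i j k where "x \<in> T i" "y \<in> T j" "z \<in> T k" using xyz by blast
    then have "x \<in> T (i + j + k)" "y \<in> T (i + j + k)" "z \<in> T (i + j + k)"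
      using mono[of i "i + j + k"] mono[of j "i + j + k"] mono[of k "i + j + k"] by auto
    then have "f (c, x, y, z) \<in> T (Suc (i + j + k))"
      using c unfolding TS by blast
    then show ?thesis by (auto simp: f_def)
  qed
  have z: "\<zero>\<^bsub>M\<^esub> \<in> \<Union> (range T)" and o: "\<one>\<^bsub>M\<^esub> \<in> \<Union> (range T)"
    and TM: "\<Union> (range T) \<subseteq> carrier M"
    using T0 sub by blast+
  have "unital_subalgebra (\<Union> (range T)) R M"
  proof (rule unital_subalgebraI[OF TM o])
    fix x y assume xy: "x \<in> \<Union> (range T)" "y \<in> \<Union> (range T)"
    then have "x \<in> carrier M" "y \<in> carrier M" using TM by auto
    then show "x \<oplus>\<^bsub>M\<^esub> y \<in> \<Union> (range T)" "x \<otimes>\<^bsub>M\<^esub> y \<in> \<Union> (range T)"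
      using step[OF R.one_closed xy o] step[OF R.zero_closed o xy] by auto
  next
    fix c x assume cx: "c \<in> carrier R" "x \<in> \<Union> (range T)"
    then have "x \<in> carrier M" using TM by auto
    then show "c \<odot>\<^bsub>M\<^esub> x \<in> \<Union> (range T)" using step[OF cx z z] cx by auto
  qed
  moreover have "S \<subseteq> \<Union> (range T)" using T0 by blast
  ultimately have "algebra_generated R M S \<subseteq> \<Union> (range T)"
    by (rule algebra_generated_least)
  then show ?thesis by (rule countable_subset) (use cnt in auto)
qed

section \<open>Homomorphic images and quotients\<close>

lemma algebra_homD:
  assumes "f \<in> algebra_hom K M N"
  shows "\<And>x. x \<in> carrier M \<Longrightarrow> f x \<in> carrier N"
    and "\<And>x y. \<lbrakk>x \<in> carrier M; y \<in> carrier M\<rbrakk> \<Longrightarrow> f (x \<oplus>\<^bsub>M\<^esub> y) = f x \<oplus>\<^bsub>N\<^esub> f y"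
    and "\<And>x y. \<lbrakk>x \<in> carrier M; y \<in> carrier M\<rbrakk> \<Longrightarrow> f (x \<otimes>\<^bsub>M\<^esub> y) = f x \<otimes>\<^bsub>N\<^esub> f y"
    and "\<And>c x. \<lbrakk>c \<in> carrier K; x \<in> carrier M\<rbrakk> \<Longrightarrow> f (c \<odot>\<^bsub>M\<^esub> x) = c \<odot>\<^bsub>N\<^esub> f x"
    and "f \<one>\<^bsub>M\<^esub> = \<one>\<^bsub>N\<^esub>"
  using assms by (auto simp: algebra_hom_def ring_hom_def)

lemma algebra_homI:
  assumes "\<And>x. x \<in> carrier M \<Longrightarrow> f x \<in> carrier N"
    and "\<And>x y. \<lbrakk>x \<in> carrier M; y \<in> carrier M\<rbrakk> \<Longrightarrow> f (x \<oplus>\<^bsub>M\<^esub> y) = f x \<oplus>\<^bsub>N\<^esub> f y"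
    and "\<And>x y. \<lbrakk>x \<in> carrier M; y \<in> carrier M\<rbrakk> \<Longrightarrow> f (x \<otimes>\<^bsub>M\<^esub> y) = f x \<otimes>\<^bsub>N\<^esub> f y"
    and "\<And>c x. \<lbrakk>c \<in> carrier K; x \<in> carrier M\<rbrakk> \<Longrightarrow> f (c \<odot>\<^bsub>M\<^esub> x) = c \<odot>\<^bsub>N\<^esub> f x"
    and "f \<one>\<^bsub>M\<^esub> = \<one>\<^bsub>N\<^esub>"
  shows "f \<in> algebra_hom K M N"
  using assms by (auto simp: algebra_hom_def ring_hom_def)

text \<open>The preimage of the subalgebra generated by the image of \<open>S\<close> is a
  subalgebra containing \<open>S\<close>, hence all of \<open>M\<close>; surjectivity carries this
  over to \<open>N\<close>.\<close>

lemma algebra_generated_image: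
  assumes "assoc_algebra K M" "assoc_algebra K N" and f: "f \<in> algebra_hom K M N"
    and surj: "f ` carrier M = carrier N"
    and S: "S \<subseteq> carrier M" "algebra_generated K M S = carrier M"
  shows "algebra_generated K N (f ` S) = carrier N"
proof
  interpret M: assoc_algebra K M by fact
  interpret N: assoc_algebra K N by fact
  have fS: "f ` S \<subseteq> carrier N" using S surj by blast
  show "algebra_generated K N (f ` S) \<subseteq> carrier N"
    using N.unital_subalgebraE(1)[OF N.algebra_generated_subalgebra[OF fS]] .
  let ?H = "algebra_generated K N (f ` S)"
  note H = N.unital_subalgebraE[OF N.algebra_generated_subalgebra[OF fS]]
  have "unital_subalgebra {x \<in> carrier M. f x \<in> ?H} K M"
    by (rule M.unital_subalgebraI) (auto simp: algebra_homD[OF f] H)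
  then have "carrier M \<subseteq> {x \<in> carrier M. f x \<in> ?H}"
    unfolding S(2)[symmetric]
    by (rule algebra_generated_least) (use S algebra_generated_incl[of "f ` S" K N] in auto)
  then have "f ` carrier M \<subseteq> ?H" by auto
  then show "carrier N \<subseteq> ?H" unfolding surj .
qed

lemma (in assoc_algebra) ideal_smult_closed:
  assumes "ideal I M" "c \<in> carrier R" "x \<in> I"
  shows "c \<odot>\<^bsub>M\<^esub> x \<in> I"
proof -
  interpret I: ideal I M by fact
  have "x \<in> carrier M" using assms I.a_subset by auto
  then have "c \<odot>\<^bsub>M\<^esub> x = (c \<odot>\<^bsub>M\<^esub> \<one>\<^bsub>M\<^esub>) \<otimes>\<^bsub>M\<^esub> x"
    using assms by (simp add: smult_mult_left)
  then show ?thesis using assms I.I_l_closed by simp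
qed

text \<open>The quotient by \<open>I\<close> with its cosets renamed by natural numbers, which
  countability of \<open>M\<close> allows. The carrier then lies in a fixed type, whatever the type
  on which \<open>M\<close> lives.\<close>

lemma (in assoc_algebra) countable_quotient:
  assumes cnt: "countable (carrier M)" and I: "ideal I M"
  obtains B :: "('k, nat) module" and f where "assoc_algebra R B" "f \<in> algebra_hom R M B"
    "f ` carrier M = carrier B" "\<And>x. x \<in> carrier M \<Longrightarrow> f x = \<zero>\<^bsub>B\<^esub> \<longleftrightarrow> x \<in> I"
proof -
  interpret I: ideal I M by fact
  \<comment> \<open>Here \<open>q x\<close> is the coset of \<open>x\<close>, \<open>k\<close>
    numbers the cosets, and \<open>g\<close> picks a representative of a numbered coset.\<close>
  define q where "q x = I +>\<^bsub>M\<^esub> x" for x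
  define k where "k = to_nat_on (q ` carrier M)"
  define f where "f x = k (q x)" for x
  define g where "g = inv_into (carrier M) f"
  have inj: "inj_on k (q ` carrier M)"
    unfolding k_def using cnt by (intro inj_on_to_nat_on) auto
  have f_eq: "f x = f y \<longleftrightarrow> q x = q y" if "x \<in> carrier M" "y \<in> carrier M" for x y
    using that inj by (auto simp: f_def inj_on_def)
  have g: "g (f x) \<in> carrier M" "q (g (f x)) = q x" if "x \<in> carrier M" for x
  proof -
    have "f x \<in> f ` carrier M" using that by blast
    from inv_into_into[OF this] f_inv_into_f[OF this] that
    show "g (f x) \<in> carrier M" "q (g (f x)) = q x" by (auto simp: g_def f_eq)
  qed
  have q_add: "q (x \<oplus>\<^bsub>M\<^esub> y) = q x <+>\<^bsub>M\<^esub> q y" if "x \<in> carrier M" "y \<in> carrier M" for x y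
    using that by (simp add: q_def I.a_rcos_sum)
  have q_mult: "q (x \<otimes>\<^bsub>M\<^esub> y) = [mod I:] q x \<Otimes>\<^bsub>M\<^esub> q y" if "x \<in> carrier M" "y \<in> carrier M" for x y
    using that by (simp add: q_def I.rcoset_mult_add)
  have q_eq: "q x = q y \<longleftrightarrow> x \<ominus>\<^bsub>M\<^esub> y \<in> I" if "x \<in> carrier M" "y \<in> carrier M" for x y
    unfolding q_def using ring.quotient_eq_iff_same_a_r_cos[OF ring_axioms I that] by simp
  have q_smult: "q (c \<odot>\<^bsub>M\<^esub> x) = q (c \<odot>\<^bsub>M\<^esub> y)"
    if "x \<in> carrier M" "y \<in> carrier M" "c \<in> carrier R" "q x = q y" for c x y
  proof -
    have "c \<odot>\<^bsub>M\<^esub> x \<ominus>\<^bsub>M\<^esub> c \<odot>\<^bsub>M\<^esub> y = c \<odot>\<^bsub>M\<^esub> (x \<ominus>\<^bsub>M\<^esub> y)"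
      using that by (simp add: M.minus_eq smult_r_distr smult_r_minus)
    then show ?thesis using that ideal_smult_closed[OF I] by (simp add: q_eq)
  qed
  \<comment> \<open>Operations are computed on representatives; \<open>q_add\<close>,
    \<open>q_mult\<close> and \<open>q_smult\<close> make the results independent of the choice, so
    \<open>f\<close> respects them.\<close>
  define B where "B = \<lparr>carrier = f ` carrier M,
    monoid.mult = \<lambda>m n. f (g m \<otimes>\<^bsub>M\<^esub> g n), monoid.one = f \<one>\<^bsub>M\<^esub>, ring.zero = f \<zero>\<^bsub>M\<^esub>,
    ring.add = \<lambda>m n. f (g m \<oplus>\<^bsub>M\<^esub> g n), smult = \<lambda>c m. f (c \<odot>\<^bsub>M\<^esub> g m)\<rparr>"
  have carB: "carrier B = f ` carrier M" by (simp add: B_def)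
  have B: "\<one>\<^bsub>B\<^esub> = f \<one>\<^bsub>M\<^esub>" "\<zero>\<^bsub>B\<^esub> = f \<zero>\<^bsub>M\<^esub>"
    "\<And>x y. \<lbrakk>x \<in> carrier M; y \<in> carrier M\<rbrakk> \<Longrightarrow> f x \<otimes>\<^bsub>B\<^esub> f y = f (x \<otimes>\<^bsub>M\<^esub> y)"
    "\<And>x y. \<lbrakk>x \<in> carrier M; y \<in> carrier M\<rbrakk> \<Longrightarrow> f x \<oplus>\<^bsub>B\<^esub> f y = f (x \<oplus>\<^bsub>M\<^esub> y)"
    "\<And>c x. \<lbrakk>c \<in> carrier R; x \<in> carrier M\<rbrakk> \<Longrightarrow> c \<odot>\<^bsub>B\<^esub> f x = f (c \<odot>\<^bsub>M\<^esub> x)"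
    using q_smult[OF g(1) _ _ g(2)] by (simp_all add: B_def f_eq g q_add q_mult)
  have "abelian_group B"
  proof (rule abelian_groupI)
    fix u assume "u \<in> carrier B"
    then obtain x where x: "x \<in> carrier M" "u = f x" unfolding carB by blast
    then have "f (\<ominus>\<^bsub>M\<^esub> x) \<in> carrier B" "f (\<ominus>\<^bsub>M\<^esub> x) \<oplus>\<^bsub>B\<^esub> u = \<zero>\<^bsub>B\<^esub>"
      by (auto simp: carB B M.l_neg)
    then show "\<exists>v\<in>carrier B. v \<oplus>\<^bsub>B\<^esub> u = \<zero>\<^bsub>B\<^esub>" by blast
  qed (auto simp: carB B M.a_ac)
  moreover have "monoid B"
    by (rule monoidI) (auto simp: carB B m_assoc)
  ultimately have "ring B"
    by (rule ringI) (auto simp: carB B l_distr r_distr)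
  have "module R B"
    by (rule moduleI) (auto simp: carB B R.is_cring \<open>abelian_group B\<close>
        smult_l_distr smult_r_distr smult_assoc1)
  show ?thesis
  proof (rule that[of B f])
    show "assoc_algebra R B"
      by (rule assoc_algebraI)
        (auto simp: carB B \<open>ring B\<close> \<open>module R B\<close> smult_mult_left smult_mult_right)
    show "f \<in> algebra_hom R M B"
      by (rule algebra_homI) (auto simp: carB B)
    show "f ` carrier M = carrier B" by (simp add: carB)
    show "f x = \<zero>\<^bsub>B\<^esub> \<longleftrightarrow> x \<in> I" if "x \<in> carrier M" for x
      using that by (simp add: B f_eq q_eq M.minus_eq)
  qed
qed

text \<open>The preimage of an ideal of \<open>B\<close> contains the kernel \<open>I\<close>, so by
  maximality it is \<open>I\<close> or all of \<open>M\<close>; surjectivity of \<open>f\<close>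
  brings this back to \<open>B\<close>.\<close>

lemma simple_algebra_quotient:
  assumes "assoc_algebra K M" "assoc_algebra K B" and f: "f \<in> algebra_hom K M B"
    and surj: "f ` carrier M = carrier B"
    and ker: "\<And>x. x \<in> carrier M \<Longrightarrow> f x = \<zero>\<^bsub>B\<^esub> \<longleftrightarrow> x \<in> I"
    and I: "maximalideal I M"
  shows "simple_algebra K B"
proof -
  interpret M: assoc_algebra K M by fact
  interpret B: assoc_algebra K B by fact
  interpret I: maximalideal I M by fact
  have "\<one>\<^bsub>M\<^esub> \<notin> I" using I.one_imp_carrier I.I_notcarr by blast
  then have "\<one>\<^bsub>B\<^esub> \<noteq> \<zero>\<^bsub>B\<^esub>" using ker[of "\<one>\<^bsub>M\<^esub>"] algebra_homD[OF f] by auto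
  then have "carrier B \<noteq> {\<zero>\<^bsub>B\<^esub>}" using B.one_closed by auto
  moreover have "J = {\<zero>\<^bsub>B\<^esub>} \<or> J = carrier B" if "ideal J B" for J
  proof -
    interpret J: ideal J B by fact
    have Jsub: "J \<subseteq> carrier B" by (rule J.a_subset)
    let ?L = "{x \<in> carrier M. f x \<in> J}"
    have L: "ideal ?L M"
      by (rule M.idealI')
        (use ker[of "\<zero>\<^bsub>M\<^esub>"] I.zero_closed in
          \<open>auto simp: algebra_homD[OF f] J.I_l_closed J.I_r_closed intro!: exI[of _ "\<zero>\<^bsub>M\<^esub>"]\<close>)
    have "I \<subseteq> ?L" using ker I.a_subset by force
    with L have "?L = I \<or> ?L = carrier M" by (intro I.I_maximal) auto
    then show ?thesis
    proof
      assume LI: "?L = I"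
      have "J \<subseteq> {\<zero>\<^bsub>B\<^esub>}"
      proof
        fix j assume j: "j \<in> J"
        then obtain x where x: "x \<in> carrier M" "j = f x" using Jsub surj by blast
        then have "x \<in> I" using j LI by blast
        then show "j \<in> {\<zero>\<^bsub>B\<^esub>}" using x ker by simp
      qed
      then show ?thesis using J.zero_closed by blast
    next
      assume "?L = carrier M"
      then have "f ` carrier M \<subseteq> J" by auto
      then show ?thesis using Jsub surj by simp
    qed
  qed
  ultimately show ?thesis by (auto simp: simple_algebra_def \<open>assoc_algebra K B\<close>)
qed

section \<open>Endomorphisms of spaces of multilinear functions\<close>

text \<open>Viewing the scalars as a module over themselves lets \<open>function_module\<close> also
  provide scalar-valued functions.\<close>

definition scalar_module :: "('k, 'm) ring_scheme \<Rightarrow> ('k, 'k) module" where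
  "scalar_module K = \<lparr>carrier = carrier K, monoid.mult = monoid.mult K, monoid.one = \<one>\<^bsub>K\<^esub>,
     ring.zero = \<zero>\<^bsub>K\<^esub>, ring.add = ring.add K, smult = monoid.mult K\<rparr>"

lemma (in cring) scalar_module: "module R (scalar_module R)"
proof (rule moduleI)
  show "cring R" by (rule is_cring)
  show "abelian_group (scalar_module R)"
    by (rule abelian_groupI) (auto simp: scalar_module_def a_ac intro!: bexI[of _ "\<ominus> _"] l_neg)
qed (auto simp: scalar_module_def l_distr r_distr m_assoc)

definition function_module :: "('k, 'a, 'n) module_scheme \<Rightarrow> ('k, 't \<Rightarrow> 'a) module" where
  "function_module M = \<lparr>carrier = {f. range f \<subseteq> carrier M},
     monoid.mult = (\<lambda>f g t. f t \<otimes>\<^bsub>M\<^esub> g t), monoid.one = (\<lambda>_. \<one>\<^bsub>M\<^esub>), ring.zero = (\<lambda>_. \<zero>\<^bsub>M\<^esub>),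
     ring.add = (\<lambda>f g t. f t \<oplus>\<^bsub>M\<^esub> g t), smult = (\<lambda>c f t. c \<odot>\<^bsub>M\<^esub> f t)\<rparr>"

lemma (in module) function_module: "module R (function_module M)"
proof (rule moduleI)
  show "cring R" by (rule R.is_cring)
  show "abelian_group (function_module M :: ('a, 't \<Rightarrow> 'c) module)"
  proof (rule abelian_groupI)
    fix f assume "f \<in> carrier (function_module M :: ('a, 't \<Rightarrow> 'c) module)"
    then show "\<exists>g\<in>carrier (function_module M). g \<oplus>\<^bsub>function_module M\<^esub> f = \<zero>\<^bsub>function_module M\<^esub>"
      by (intro bexI[of _ "\<lambda>t. \<ominus>\<^bsub>M\<^esub> f t"])
        (auto simp: function_module_def image_subset_iff M.l_neg)
  qed (auto simp: function_module_def image_subset_iff M.a_ac)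
qed (auto simp: function_module_def image_subset_iff smult_l_distr smult_r_distr smult_assoc1)

text \<open>Endomorphisms are total functions on the type, normalised to \<open>\<zero>\<close> off the carrier.\<close>

definition endomorphism_algebra ::
    "('k, 'm) ring_scheme \<Rightarrow> ('k, 'a, 'n) module_scheme \<Rightarrow> ('k, 'a \<Rightarrow> 'a) module" where
  "endomorphism_algebra K V = (function_module V)
    \<lparr>carrier := {T. range T \<subseteq> carrier V \<and> (\<forall>v. v \<notin> carrier V \<longrightarrow> T v = \<zero>\<^bsub>V\<^esub>) \<and>
       (\<forall>v\<in>carrier V. \<forall>w\<in>carrier V. T (v \<oplus>\<^bsub>V\<^esub> w) = T v \<oplus>\<^bsub>V\<^esub> T w) \<and>
       (\<forall>c\<in>carrier K. \<forall>v\<in>carrier V. T (c \<odot>\<^bsub>V\<^esub> v) = c \<odot>\<^bsub>V\<^esub> T v)},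
     monoid.mult := (\<circ>), monoid.one := (\<lambda>v. if v \<in> carrier V then v else \<zero>\<^bsub>V\<^esub>)\<rparr>"

text \<open>Linear maps form a submodule of the module of all functions, which supplies the additive
  structure; the product is composition.\<close>

lemma (in module) endomorphism_algebra: "assoc_algebra R (endomorphism_algebra R M)"
proof -
  interpret F: module R "function_module M :: ('a, 'c \<Rightarrow> 'c) module" by (rule function_module)
  let ?E = "endomorphism_algebra R M"
  have sub: "submodule (carrier ?E) R (function_module M)"
  proof (rule F.submoduleI')
    show "carrier ?E \<noteq> {}"
    proof -
      have "(\<lambda>_. \<zero>\<^bsub>M\<^esub>) \<in> carrier ?E" by (auto simp: endomorphism_algebra_def)
      then show ?thesis by blast
    qed
  next
    fix c S T assume c: "c \<in> carrier R" and "S \<in> carrier ?E" "T \<in> carrier ?E"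
    then have ST: "\<And>v. S v \<in> carrier M" "\<And>v. T v \<in> carrier M"
      "\<And>v. v \<notin> carrier M \<Longrightarrow> S v = \<zero>\<^bsub>M\<^esub>" "\<And>v. v \<notin> carrier M \<Longrightarrow> T v = \<zero>\<^bsub>M\<^esub>"
      "\<And>v w. \<lbrakk>v \<in> carrier M; w \<in> carrier M\<rbrakk> \<Longrightarrow> S (v \<oplus>\<^bsub>M\<^esub> w) = S v \<oplus>\<^bsub>M\<^esub> S w"
      "\<And>v w. \<lbrakk>v \<in> carrier M; w \<in> carrier M\<rbrakk> \<Longrightarrow> T (v \<oplus>\<^bsub>M\<^esub> w) = T v \<oplus>\<^bsub>M\<^esub> T w"
      "\<And>d v. \<lbrakk>d \<in> carrier R; v \<in> carrier M\<rbrakk> \<Longrightarrow> S (d \<odot>\<^bsub>M\<^esub> v) = d \<odot>\<^bsub>M\<^esub> S v"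
      "\<And>d v. \<lbrakk>d \<in> carrier R; v \<in> carrier M\<rbrakk> \<Longrightarrow> T (d \<odot>\<^bsub>M\<^esub> v) = d \<odot>\<^bsub>M\<^esub> T v"
      by (auto simp: endomorphism_algebra_def image_subset_iff)
    \<comment> \<open>Commutativity of the scalars makes a scalar multiple of a linear map
      linear.\<close>
    have "c \<odot>\<^bsub>M\<^esub> (d \<odot>\<^bsub>M\<^esub> v) = d \<odot>\<^bsub>M\<^esub> (c \<odot>\<^bsub>M\<^esub> v)" if "d \<in> carrier R" "v \<in> carrier M" for d v
      using that c by (simp add: smult_assoc1[symmetric] R.m_comm)
    then show "S \<oplus>\<^bsub>function_module M\<^esub> c \<odot>\<^bsub>function_module M\<^esub> T \<in> carrier ?E"
      using c by (auto simp: endomorphism_algebra_def function_module_def ST smult_r_distr M.a_ac)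
  qed (auto simp: endomorphism_algebra_def function_module_def)
  \<comment> \<open>The submodule and \<open>?E\<close> differ only in product and unit, which do
    not occur in the module axioms.\<close>
  have mod: "module R ?E"
    using submodule.submodule_is_module[OF sub F.module_axioms]
    by (simp add: endomorphism_algebra_def module_def abelian_group_def abelian_monoid_def
        abelian_group_axioms_def module_axioms_def)
  then interpret E: module R ?E .
  \<comment> \<open>Operators vanish off the carrier, and a composite does so too because the outer
    operator sends zero to zero. The right unit law off the carrier rests on the same fact.\<close>
  have zero: "T \<zero>\<^bsub>M\<^esub> = \<zero>\<^bsub>M\<^esub>" if "T \<in> carrier ?E" for T
  proof -
    have "\<forall>c\<in>carrier R. \<forall>v\<in>carrier M. T (c \<odot>\<^bsub>M\<^esub> v) = c \<odot>\<^bsub>M\<^esub> T v"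
      using that by (simp add: endomorphism_algebra_def)
    then have "T (\<zero> \<odot>\<^bsub>M\<^esub> \<zero>\<^bsub>M\<^esub>) = \<zero> \<odot>\<^bsub>M\<^esub> T \<zero>\<^bsub>M\<^esub>"
      using R.zero_closed M.zero_closed by blast
    moreover have "T \<zero>\<^bsub>M\<^esub> \<in> carrier M" using that by (auto simp: endomorphism_algebra_def)
    ultimately show ?thesis by simp
  qed
  show ?thesis
  proof (rule assoc_algebraI[OF mod])
    show "ring ?E"
    proof (rule ringI)
      show "abelian_group ?E" ..
      show "monoid ?E"
      proof (rule monoidI)
        fix S T assume "S \<in> carrier ?E" "T \<in> carrier ?E"
        then show "S \<otimes>\<^bsub>?E\<^esub> T \<in> carrier ?E"
          using zero[of S] by (auto simp: endomorphism_algebra_def image_subset_iff)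
      next
        fix T assume "T \<in> carrier ?E"
        then show "T \<otimes>\<^bsub>?E\<^esub> \<one>\<^bsub>?E\<^esub> = T"
          using zero[of T] by (auto simp: endomorphism_algebra_def fun_eq_iff)
      qed (auto simp: endomorphism_algebra_def fun_eq_iff image_subset_iff)
    qed (auto simp: endomorphism_algebra_def function_module_def fun_eq_iff image_subset_iff)
  qed (auto simp: endomorphism_algebra_def function_module_def fun_eq_iff image_subset_iff)
qed

lemma endomorphism_algebra_simps:
  "S \<otimes>\<^bsub>endomorphism_algebra K V\<^esub> T = S \<circ> T"
  "\<one>\<^bsub>endomorphism_algebra K V\<^esub> = (\<lambda>v. if v \<in> carrier V then v else \<zero>\<^bsub>V\<^esub>)"
  "\<zero>\<^bsub>endomorphism_algebra K V\<^esub> = (\<lambda>_. \<zero>\<^bsub>V\<^esub>)"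
  "S \<oplus>\<^bsub>endomorphism_algebra K V\<^esub> T = (\<lambda>v. S v \<oplus>\<^bsub>V\<^esub> T v)"
  "c \<odot>\<^bsub>endomorphism_algebra K V\<^esub> T = (\<lambda>v. c \<odot>\<^bsub>V\<^esub> T v)"
  by (simp_all add: endomorphism_algebra_def function_module_def)

definition extend_by_zero :: "('k, 'a, 'n) module_scheme \<Rightarrow> ('a \<Rightarrow> 'a) \<Rightarrow> 'a \<Rightarrow> 'a" where
  "extend_by_zero V T v = (if v \<in> carrier V then T v else \<zero>\<^bsub>V\<^esub>)"

lemma (in module) extend_by_zero_endomorphism:
  assumes "\<And>v. v \<in> carrier M \<Longrightarrow> T v \<in> carrier M"
    and "\<And>v w. \<lbrakk>v \<in> carrier M; w \<in> carrier M\<rbrakk> \<Longrightarrow> T (v \<oplus>\<^bsub>M\<^esub> w) = T v \<oplus>\<^bsub>M\<^esub> T w"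
    and "\<And>c v. \<lbrakk>c \<in> carrier R; v \<in> carrier M\<rbrakk> \<Longrightarrow> T (c \<odot>\<^bsub>M\<^esub> v) = c \<odot>\<^bsub>M\<^esub> T v"
  shows "extend_by_zero M T \<in> carrier (endomorphism_algebra R M)"
  using assms by (auto simp: endomorphism_algebra_def extend_by_zero_def)

lemma endomorphismD:
  assumes "T \<in> carrier (endomorphism_algebra K V)"
  shows "T v \<in> carrier V" "v \<notin> carrier V \<Longrightarrow> T v = \<zero>\<^bsub>V\<^esub>"
    "\<lbrakk>v \<in> carrier V; w \<in> carrier V\<rbrakk> \<Longrightarrow> T (v \<oplus>\<^bsub>V\<^esub> w) = T v \<oplus>\<^bsub>V\<^esub> T w"
    "\<lbrakk>c \<in> carrier K; v \<in> carrier V\<rbrakk> \<Longrightarrow> T (c \<odot>\<^bsub>V\<^esub> v) = c \<odot>\<^bsub>V\<^esub> T v"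
  using assms by (auto simp: endomorphism_algebra_def)

lemma endomorphism_eqI:
  assumes "S \<in> carrier (endomorphism_algebra K V)" "T \<in> carrier (endomorphism_algebra K V)"
    and "\<And>v. v \<in> carrier V \<Longrightarrow> S v = T v"
  shows "S = T"
proof
  show "S v = T v" for v
    using assms(3) endomorphismD(2)[OF assms(1), of v] endomorphismD(2)[OF assms(2), of v]
    by (cases "v \<in> carrier V") auto
qed

text \<open>In a pair \<open>(n, b)\<close>, \<open>n\<close> is a row number and \<open>b\<close> a
  sequence of algebra elements, so \<open>F\<close> encodes a sequence of functions of
  \<open>b\<close>, each linear in every single entry. The rows give room for coding countably many
  operators by two; the value zero outside sequences in \<open>A\<close> makes the extension to the
  whole type unique.\<close>

definition multilinear_sequences ::
    "('k, 'm) ring_scheme \<Rightarrow> ('k, 'a, 'n) module_scheme \<Rightarrow> ('k, nat \<times> (nat \<Rightarrow> 'a) \<Rightarrow> 'k) module"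
  where "multilinear_sequences K A = (function_module (scalar_module K))\<lparr>carrier :=
    {F. (\<forall>p. F p \<in> carrier K) \<and> (\<forall>n b. \<not> range b \<subseteq> carrier A \<longrightarrow> F (n, b) = \<zero>\<^bsub>K\<^esub>) \<and>
      (\<forall>n b i. range b \<subseteq> carrier A \<longrightarrow> (\<forall>x\<in>carrier A. \<forall>y\<in>carrier A.
          F (n, b(i := x \<oplus>\<^bsub>A\<^esub> y)) = F (n, b(i := x)) \<oplus>\<^bsub>K\<^esub> F (n, b(i := y))) \<and>
        (\<forall>c\<in>carrier K. \<forall>x\<in>carrier A. F (n, b(i := c \<odot>\<^bsub>A\<^esub> x)) = c \<otimes>\<^bsub>K\<^esub> F (n, b(i := x))))}\<rparr>"

lemma multilinear_sequences_simps:
  "F \<oplus>\<^bsub>multilinear_sequences K A\<^esub> G = (\<lambda>p. F p \<oplus>\<^bsub>K\<^esub> G p)"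
  "c \<odot>\<^bsub>multilinear_sequences K A\<^esub> F = (\<lambda>p. c \<otimes>\<^bsub>K\<^esub> F p)"
  "\<zero>\<^bsub>multilinear_sequences K A\<^esub> = (\<lambda>_. \<zero>\<^bsub>K\<^esub>)"
  by (simp_all add: multilinear_sequences_def function_module_def scalar_module_def)

lemma multilinear_sequencesI:
  assumes "\<And>n b. F (n, b) \<in> carrier K" "\<And>n b. \<not> range b \<subseteq> carrier A \<Longrightarrow> F (n, b) = \<zero>\<^bsub>K\<^esub>"
    and "\<And>n b i x y. \<lbrakk>range b \<subseteq> carrier A; x \<in> carrier A; y \<in> carrier A\<rbrakk> \<Longrightarrow>
      F (n, b(i := x \<oplus>\<^bsub>A\<^esub> y)) = F (n, b(i := x)) \<oplus>\<^bsub>K\<^esub> F (n, b(i := y))"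
    and "\<And>n b i c x. \<lbrakk>range b \<subseteq> carrier A; c \<in> carrier K; x \<in> carrier A\<rbrakk> \<Longrightarrow>
      F (n, b(i := c \<odot>\<^bsub>A\<^esub> x)) = c \<otimes>\<^bsub>K\<^esub> F (n, b(i := x))"
  shows "F \<in> carrier (multilinear_sequences K A)"
  using assms by (simp add: multilinear_sequences_def)

lemma multilinear_sequencesD:
  assumes "F \<in> carrier (multilinear_sequences K A)"
  shows "F p \<in> carrier K" "\<not> range b \<subseteq> carrier A \<Longrightarrow> F (n, b) = \<zero>\<^bsub>K\<^esub>"
    "\<lbrakk>range b \<subseteq> carrier A; x \<in> carrier A; y \<in> carrier A\<rbrakk> \<Longrightarrow>
      F (n, b(i := x \<oplus>\<^bsub>A\<^esub> y)) = F (n, b(i := x)) \<oplus>\<^bsub>K\<^esub> F (n, b(i := y))"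
    "\<lbrakk>range b \<subseteq> carrier A; c \<in> carrier K; x \<in> carrier A\<rbrakk> \<Longrightarrow>
      F (n, b(i := c \<odot>\<^bsub>A\<^esub> x)) = c \<otimes>\<^bsub>K\<^esub> F (n, b(i := x))"
  using assms by (cases p; simp add: multilinear_sequences_def)+

text \<open>No condition links different rows, so a function assembled from rows of members of the
  space is again a member.\<close>

lemma multilinear_sequences_rowsI:
  assumes "\<And>n. \<exists>G\<in>carrier (multilinear_sequences K A). \<exists>m. \<forall>b. F (n, b) = G (m, b)"
  shows "F \<in> carrier (multilinear_sequences K A)"
proof -
  obtain G m where G: "\<And>n. G n \<in> carrier (multilinear_sequences K A)"
    and F: "\<And>n b. F (n, b) = G n (m n, b)"
    using assms by metis
  show ?thesis
    by (rule multilinear_sequencesI) (simp_all add: F multilinear_sequencesD[OF G])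
qed

lemma (in cring) multilinear_sequences: "module R (multilinear_sequences R A)"
proof -
  interpret F: module R "function_module (scalar_module R) :: ('a, nat \<times> (nat \<Rightarrow> 'c) \<Rightarrow> 'a) module"
    by (rule module.function_module[OF scalar_module])
  let ?V = "multilinear_sequences R A"
  have simps: "F \<oplus>\<^bsub>function_module (scalar_module R)\<^esub> G = (\<lambda>p. F p \<oplus> G p)"
    "c \<odot>\<^bsub>function_module (scalar_module R)\<^esub> F = (\<lambda>p. c \<otimes> F p)"
    for F G :: "nat \<times> (nat \<Rightarrow> 'c) \<Rightarrow> 'a" and c
    by (simp_all add: function_module_def scalar_module_def)
  have "submodule (carrier ?V) R (function_module (scalar_module R))"
  proof (rule F.submoduleI')
    have "(\<lambda>_. \<zero>) \<in> carrier ?V" by (rule multilinear_sequencesI) auto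
    then show "carrier ?V \<noteq> {}" by blast
    show "carrier ?V \<subseteq> carrier (function_module (scalar_module R))"
      by (auto simp: function_module_def scalar_module_def multilinear_sequencesD)
  next
    fix c F G assume c: "c \<in> carrier R" and FG: "F \<in> carrier ?V" "G \<in> carrier ?V"
    show "F \<oplus>\<^bsub>function_module (scalar_module R)\<^esub> c \<odot>\<^bsub>function_module (scalar_module R)\<^esub> G
      \<in> carrier ?V"
      unfolding simps using c
      by (intro multilinear_sequencesI)
        (simp_all add: multilinear_sequencesD[OF FG(1)] multilinear_sequencesD[OF FG(2)]
          r_distr a_ac m_lcomm)
  qed
  from submodule.submodule_is_module[OF this F.module_axioms]
  show ?thesis by (simp add: multilinear_sequences_def)
qed

section \<open>Embedding into a simple algebra with two generators\<close>

text \<open>A two-letter encoding of Sierpinski type: splitting the index set as \<open>nat \<times> nat\<close>, the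
  operator \<open>a\<close> shifts the first coordinate, \<open>a b\<close> restricts to first coordinate \<open>0\<close>, and \<open>a b b\<close>
  stacks all the \<open>c n\<close>, so that \<open>c n = (a b) a\<^sup>n (a b b)\<close>.\<close>

lemma (in cring) sequence_in_two_generated_algebra:
  fixes c :: "nat \<Rightarrow> (nat \<times> (nat \<Rightarrow> 'c) \<Rightarrow> 'a) \<Rightarrow> nat \<times> (nat \<Rightarrow> 'c) \<Rightarrow> 'a"
    and A :: "('a, 'c, 'n) module_scheme"
  defines "V \<equiv> multilinear_sequences R A"
  defines "E \<equiv> endomorphism_algebra R V"
  assumes c: "\<And>n. c n \<in> carrier E"
  obtains a b where "a \<in> carrier E" "b \<in> carrier E" "range c \<subseteq> algebra_generated R E {a, b}"
proof -
  interpret V: module R V unfolding V_def by (rule multilinear_sequences)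
  interpret E: assoc_algebra R E unfolding E_def by (rule V.endomorphism_algebra)
  note simps = multilinear_sequences_simps[of R A, folded V_def]
  note rowsI = multilinear_sequences_rowsI[of R A, folded V_def]
  note cD = endomorphismD[of _ R V, folded E_def, OF c]
  \<comment> \<open>A row number is read as a pair of a block \<open>p\<close> and a position
    \<open>q\<close>; \<open>a0\<close> moves block \<open>p + 1\<close> to block
    \<open>p\<close>.\<close>
  define a0 where "a0 F = (\<lambda>(n, \<beta>). case prod_decode n of (p, q) \<Rightarrow> F (prod_encode (Suc p, q), \<beta>))"
    for F :: "nat \<times> (nat \<Rightarrow> 'c) \<Rightarrow> 'a"
  \<comment> \<open>Block \<open>p\<close> of \<open>x0 F\<close> is the whole of
    \<open>c p F\<close>.\<close>
  define x0 where "x0 F = (\<lambda>(n, \<beta>). case prod_decode n of (p, q) \<Rightarrow> c p F (q, \<beta>))" for F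
  \<comment> \<open>Block 0 receives the data to be coded. The remaining blocks together receive
    block 0 of \<open>F\<close>, unfolded along \<open>prod_encode\<close>; discarding block 0 by
    \<open>a\<close> therefore leaves exactly the restriction of \<open>F\<close> to block
    0.\<close>
  define b0 where "b0 F = (\<lambda>(n, \<beta>). case prod_decode n of (p, q) \<Rightarrow>
    (case p of 0 \<Rightarrow> x0 F (q, \<beta>) | Suc p' \<Rightarrow> F (prod_encode (0, prod_encode (p', q)), \<beta>)))" for F
  define a where "a = extend_by_zero V a0"
  define b where "b = extend_by_zero V b0"
  have a0: "a0 F \<in> carrier V" if "F \<in> carrier V" for F
  proof (rule rowsI)
    fix n
    obtain p q where "prod_decode n = (p, q)" by (cases "prod_decode n")
    then show "\<exists>G\<in>carrier V. \<exists>m. \<forall>\<beta>. a0 F (n, \<beta>) = G (m, \<beta>)"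
      using that by (intro bexI[of _ F] exI[of _ "prod_encode (Suc p, q)"]) (auto simp: a0_def)
  qed
  have x0: "x0 F \<in> carrier V" for F
  proof (rule rowsI)
    show "\<exists>G\<in>carrier V. \<exists>m. \<forall>\<beta>. x0 F (n, \<beta>) = G (m, \<beta>)" for n
      by (rule bexI[of _ "c (fst (prod_decode n)) F"], rule exI[of _ "snd (prod_decode n)"])
        (auto simp: x0_def cD split: prod.split)
  qed
  have b0: "b0 F \<in> carrier V" if F: "F \<in> carrier V" for F
  proof (rule rowsI)
    fix n
    obtain p q where pq: "prod_decode n = (p, q)" by (cases "prod_decode n")
    show "\<exists>G\<in>carrier V. \<exists>m. \<forall>\<beta>. b0 F (n, \<beta>) = G (m, \<beta>)"
    proof (cases p)
      case 0
      then show ?thesis by (intro bexI[of _ "x0 F"] exI[of _ q]) (auto simp: b0_def pq x0)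
    next
      case (Suc p')
      then show ?thesis
        by (intro bexI[of _ F] exI[of _ "prod_encode (0, prod_encode (p', q))"])
          (auto simp: b0_def pq F)
    qed
  qed
  have aE: "a \<in> carrier E" unfolding a_def E_def
    by (rule V.extend_by_zero_endomorphism)
      (auto simp: a0 simps, auto simp: a0_def fun_eq_iff split: prod.split)
  have x0_lin: "x0 (F \<oplus>\<^bsub>V\<^esub> G) = (\<lambda>p. x0 F p \<oplus> x0 G p)" "x0 (d \<odot>\<^bsub>V\<^esub> F) = (\<lambda>p. d \<otimes> x0 F p)"
    if "F \<in> carrier V" "G \<in> carrier V" "d \<in> carrier R" for F G d
    unfolding x0_def fun_eq_iff using cD(3)[OF that(1,2)] cD(4)[OF that(3,1)]
    by (auto simp: simps split: prod.split)
  have bE: "b \<in> carrier E" unfolding b_def E_def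
  proof (rule V.extend_by_zero_endomorphism)
    fix F G assume "F \<in> carrier V" "G \<in> carrier V"
    then show "b0 (F \<oplus>\<^bsub>V\<^esub> G) = b0 F \<oplus>\<^bsub>V\<^esub> b0 G"
      unfolding b0_def fun_eq_iff using x0_lin(1)[OF _ _ zero_closed]
      by (auto simp: simps split: prod.split nat.split)
  next
    fix d F assume "d \<in> carrier R" "F \<in> carrier V"
    then show "b0 (d \<odot>\<^bsub>V\<^esub> F) = d \<odot>\<^bsub>V\<^esub> b0 F"
      unfolding b0_def fun_eq_iff using x0_lin(2)[OF _ _ \<open>d \<in> carrier R\<close>]
      by (auto simp: simps split: prod.split nat.split)
  qed (rule b0)
  have a: "a F = a0 F" and b: "b F = b0 F" if "F \<in> carrier V" for F
    using that by (simp_all add: a_def b_def extend_by_zero_def)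
  have ab: "a (b F) (m, \<beta>) = F (prod_encode (0, m), \<beta>)" if "F \<in> carrier V" for F m \<beta>
  proof -
    obtain p q where "m = prod_encode (p, q)" by (metis prod_decode_inverse surj_pair)
    then show ?thesis using that by (simp add: a b b0) (simp add: a0_def b0_def)
  qed
  \<comment> \<open>The inner \<open>b\<close> writes \<open>x0 F\<close> into block 0, and
    \<open>a b\<close> reads block 0 off.\<close>
  have abb: "a (b (b F)) = x0 F" if "F \<in> carrier V" for F
  proof (intro ext, clarify)
    show "a (b (b F)) (m, \<beta>) = x0 F (m, \<beta>)" for m \<beta>
      using that ab[OF b0, of F m \<beta>] by (simp add: b) (simp add: b0_def)
  qed
  \<comment> \<open>The word \<open>a\<^sup>n (a b b)\<close> moves block \<open>n\<close> of
    \<open>x0 F\<close> to block 0, where \<open>a b\<close> extracts it as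
    \<open>c n F\<close>.\<close>
  define w where "w n = rec_nat (a \<otimes>\<^bsub>E\<^esub> (b \<otimes>\<^bsub>E\<^esub> b)) (\<lambda>_ T. a \<otimes>\<^bsub>E\<^esub> T) n" for n
  have w0: "w 0 = a \<otimes>\<^bsub>E\<^esub> (b \<otimes>\<^bsub>E\<^esub> b)" and wS: "w (Suc n) = a \<otimes>\<^bsub>E\<^esub> w n" for n
    by (simp_all add: w_def)
  have wE: "w n \<in> carrier E" for n
    by (induction n) (auto simp: w0 wS aE bE)
  have mult: "S \<otimes>\<^bsub>E\<^esub> T = S \<circ> T" for S T by (simp add: E_def endomorphism_algebra_simps)
  have w: "w n F (prod_encode (p, q), \<beta>) = x0 F (prod_encode (p + n, q), \<beta>)"
    if F: "F \<in> carrier V" for F n p q \<beta>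
  \<comment> \<open>Each further \<open>a\<close> raises the block number by one, so
    \<open>p\<close> has to vary in the induction.\<close>
  proof (induction n arbitrary: p)
    case 0
    then show ?case using F by (simp add: w0 mult abb)
  next
    case (Suc n)
    have "w n F \<in> carrier V" using endomorphismD(1)[of "w n" R V F] wE by (simp add: E_def)
    then show ?case using Suc[of "Suc p"] by (simp add: wS mult a a0_def)
  qed
  have c_eq: "c n = a \<otimes>\<^bsub>E\<^esub> (b \<otimes>\<^bsub>E\<^esub> w n)" for n
  proof (rule endomorphism_eqI[of _ R V, folded E_def])
    fix F assume F: "F \<in> carrier V"
    have "w n F \<in> carrier V" using endomorphismD(1)[of "w n" R V F] wE by (simp add: E_def)
    then show "c n F = (a \<otimes>\<^bsub>E\<^esub> (b \<otimes>\<^bsub>E\<^esub> w n)) F"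
      using F by (auto simp: fun_eq_iff mult ab w x0_def)
  qed (simp_all add: c aE bE wE)
  let ?H = "algebra_generated R E {a, b}"
  have "unital_subalgebra ?H R E" using aE bE by (intro E.algebra_generated_subalgebra) auto
  note H = E.unital_subalgebraE(5)[OF this]
  have ab_in: "a \<in> ?H" "b \<in> ?H" using algebra_generated_incl[of "{a, b}" R E] by auto
  have "w n \<in> ?H" for n by (induction n) (auto simp: w0 wS H ab_in)
  then have "range c \<subseteq> ?H" by (auto simp: c_eq H ab_in)
  then show ?thesis using that aE bE by blast
qed

section \<open>Action of an algebra on its multilinear functions\<close>

context assoc_algebra
begin

abbreviation (input) "V \<equiv> multilinear_sequences R M"

text \<open>The product of all \<open>\<phi> (b\<^sub>j)\<close> with \<open>\<phi> \<one> = \<one>\<close> is finite on sequences that are eventually \<open>\<one>\<close>,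
  and changing one entry does not affect this property, so zero is a multilinear extension.\<close>

lemma exists_nonzero_multilinear_sequence:
  assumes "field R" "\<one>\<^bsub>M\<^esub> \<noteq> \<zero>\<^bsub>M\<^esub>"
  shows "\<exists>F\<in>carrier V. F \<noteq> \<zero>\<^bsub>V\<^esub>"
proof -
  interpret K: field R by fact
  obtain \<phi> where \<phi>: "\<phi> \<in> carrier M \<rightarrow> carrier R" "\<phi> \<one>\<^bsub>M\<^esub> = \<one>"
    "\<And>x y. \<lbrakk>x \<in> carrier M; y \<in> carrier M\<rbrakk> \<Longrightarrow> \<phi> (x \<oplus>\<^bsub>M\<^esub> y) = \<phi> x \<oplus> \<phi> y"
    "\<And>c x. \<lbrakk>c \<in> carrier R; x \<in> carrier M\<rbrakk> \<Longrightarrow> \<phi> (c \<odot>\<^bsub>M\<^esub> x) = c \<otimes> \<phi> x"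
    using exists_linear_functional[OF assms(1) module_axioms one_closed assms(2)] by blast
  \<comment> \<open>All factors outside \<open>S b\<close> are \<open>\<phi>\<close> of the unit,
    that is 1, so for finite \<open>S b\<close> the product over \<open>S b\<close> stands for the
    infinite one.\<close>
  define S where "S b = {j. b j \<noteq> \<one>\<^bsub>M\<^esub>}" for b :: "nat \<Rightarrow> 'a"
  define P where "P b J = finprod R (\<lambda>j. \<phi> (b j)) J" for b :: "nat \<Rightarrow> 'a" and J
  define F where "F = (\<lambda>(n :: nat, b). if range b \<subseteq> carrier M \<and> finite (S b) then P b (S b) else \<zero>)"
  have P_closed: "P b J \<in> carrier R" if "range b \<subseteq> carrier M" for b J
    unfolding P_def using that \<phi>(1) by (intro R.finprod_closed) (auto simp: Pi_iff image_subset_iff)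
  \<comment> \<open>The product over \<open>S b - {i}\<close> does not involve entry
    \<open>i\<close>, so that entry enters through the factor \<open>\<phi> x\<close> alone, and
    linearity in it follows from that of \<open>\<phi>\<close>.\<close>
  have F_upd: "F (n, b(i := x)) = (if finite (S b) then \<phi> x \<otimes> P b (S b - {i}) else \<zero>)"
    if b: "range b \<subseteq> carrier M" and x: "x \<in> carrier M" for n b i x
  proof -
    have S_upd: "S (b(i := x)) = (if x = \<one>\<^bsub>M\<^esub> then S b - {i} else insert i (S b - {i}))"
      by (auto simp: S_def)
    have fin: "finite (S (b(i := x))) \<longleftrightarrow> finite (S b)" by (simp add: S_upd)
    have r: "range (b(i := x)) \<subseteq> carrier M" using b x by (auto simp: image_subset_iff)
    have P_upd: "P (b(i := x)) (S b - {i}) = P b (S b - {i})"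
      unfolding P_def using b \<phi>(1)
      by (intro R.finprod_cong') (auto simp: Pi_iff image_subset_iff)
    have "P (b(i := x)) (S (b(i := x))) = \<phi> x \<otimes> P b (S b - {i})" if "finite (S b)"
    \<comment> \<open>For \<open>x\<close> the unit, \<open>i\<close> drops out of the support and
      the missing factor is \<open>\<phi> x = 1\<close>; otherwise \<open>i\<close> belongs to the
      support and its factor is split off.\<close>
    proof (cases "x = \<one>\<^bsub>M\<^esub>")
      case True
      then have "S (b(i := x)) = S b - {i}" using S_upd by simp
      then show ?thesis using True P_upd P_closed[OF b] \<phi>(2) by simp
    next
      case False
      have "P (b(i := x)) (insert i (S b - {i})) = \<phi> x \<otimes> P (b(i := x)) (S b - {i})"
        unfolding P_def using that r \<phi>(1) x
        by (subst R.finprod_insert) (auto simp: Pi_iff image_subset_iff)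
      then show ?thesis using False P_upd S_upd by simp
    qed
    then show ?thesis using r fin by (simp add: F_def)
  qed
  have "F \<in> carrier V"
  proof (rule multilinear_sequencesI)
    show "F (n, b) \<in> carrier R" for n b using P_closed by (simp add: F_def)
    show "F (n, b) = \<zero>" if "\<not> range b \<subseteq> carrier M" for n b using that by (simp add: F_def)
    show "F (n, b(i := x \<oplus>\<^bsub>M\<^esub> y)) = F (n, b(i := x)) \<oplus> F (n, b(i := y))"
      if "range b \<subseteq> carrier M" "x \<in> carrier M" "y \<in> carrier M" for n b i x y
      using that P_closed \<phi>(1) by (auto simp: F_upd \<phi>(3) R.l_distr Pi_iff)
    show "F (n, b(i := c \<odot>\<^bsub>M\<^esub> x)) = c \<otimes> F (n, b(i := x))"
      if "range b \<subseteq> carrier M" "c \<in> carrier R" "x \<in> carrier M" for n b i c x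
      using that P_closed \<phi>(1) by (auto simp: F_upd \<phi>(4) R.m_assoc Pi_iff)
  qed
  \<comment> \<open>The constant sequence 1 has empty support, and the empty product is 1.\<close>
  moreover have "F (0, \<lambda>_. \<one>\<^bsub>M\<^esub>) = \<one>"
    by (simp add: F_def S_def P_def)
  then have "F \<noteq> \<zero>\<^bsub>V\<^esub>" using K.one_not_zero by (auto simp: multilinear_sequences_simps)
  ultimately show ?thesis by blast
qed

text \<open>Evaluated at a sequence, \<open>y\<close> puts 1 in front, \<open>h a\<close> turns this
  1 into \<open>a\<close>, and \<open>z a\<close> removes the entry again at the cost of a factor
  \<open>\<phi> a = 1\<close>. Only \<open>z a\<close> depends on the functional chosen for
  \<open>a\<close>; a single \<open>y\<close> serves all \<open>a\<close>.\<close>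

lemma exists_action_with_one_sided_inverses:
  assumes "field R"
  defines "E \<equiv> endomorphism_algebra R V"
  obtains h y z where "h \<in> algebra_hom R M E" "y \<in> carrier E"
    "\<And>a. \<lbrakk>a \<in> carrier M; a \<noteq> \<zero>\<^bsub>M\<^esub>\<rbrakk> \<Longrightarrow> z a \<in> carrier E \<and> y \<otimes>\<^bsub>E\<^esub> (h a \<otimes>\<^bsub>E\<^esub> z a) = \<one>\<^bsub>E\<^esub>"
proof -
  interpret V: module R V by (rule R.multilinear_sequences)
  interpret E: assoc_algebra R E unfolding E_def by (rule V.endomorphism_algebra)
  note simps = multilinear_sequences_simps[of R M]
  note eqI = endomorphism_eqI[of _ R V, folded E_def]
  note Esimps = endomorphism_algebra_simps[of R V, folded E_def]
  \<comment> \<open>The tests on \<open>range \<beta>\<close> keep the value zero outside sequences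
    in the carrier, as membership in the space requires.\<close>
  define h0 where "h0 a F = (\<lambda>(n, \<beta>). if range \<beta> \<subseteq> carrier M
    then F (n, \<beta>(0 := \<beta> 0 \<otimes>\<^bsub>M\<^esub> a)) else \<zero>)" for a and F :: "nat \<times> (nat \<Rightarrow> 'a) \<Rightarrow> 'k"
  define y0 where "y0 F = (\<lambda>(n, \<beta>). if range \<beta> \<subseteq> carrier M
    then F (n, case_nat \<one>\<^bsub>M\<^esub> \<beta>) else \<zero>)" for F :: "nat \<times> (nat \<Rightarrow> 'a) \<Rightarrow> 'k"
  define z0 where "z0 \<phi> F = (\<lambda>(n, \<beta>). if range \<beta> \<subseteq> carrier M
    then \<phi> (\<beta> 0) \<otimes> F (n, \<beta> \<circ> Suc) else \<zero>)" for \<phi> and F :: "nat \<times> (nat \<Rightarrow> 'a) \<Rightarrow> 'k"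
  define h where "h a = extend_by_zero V (h0 a)" for a
  define y where "y = extend_by_zero V y0"
  have upd_sub: "range (\<beta>(i := x)) \<subseteq> carrier M" if "range \<beta> \<subseteq> carrier M" "x \<in> carrier M"
    for \<beta> :: "nat \<Rightarrow> 'a" and i x
    using that by (auto simp: image_subset_iff)
  have h0: "h0 a F \<in> carrier V" if F: "F \<in> carrier V" and a: "a \<in> carrier M" for a F
  proof (rule multilinear_sequencesI)
    note FD = multilinear_sequencesD[OF F]
    show "h0 a F (n, \<beta>) \<in> carrier R" for n \<beta> by (simp add: h0_def FD)
    show "h0 a F (n, \<beta>) = \<zero>" if "\<not> range \<beta> \<subseteq> carrier M" for n \<beta> using that by (simp add: h0_def)
    fix n i x and \<beta> :: "nat \<Rightarrow> 'a" assume \<beta>: "range \<beta> \<subseteq> carrier M" and x: "x \<in> carrier M"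
    have "\<beta> 0 \<in> carrier M" using \<beta> by auto
    then have \<beta>': "range (\<beta>(0 := \<beta> 0 \<otimes>\<^bsub>M\<^esub> a)) \<subseteq> carrier M" using \<beta> a by (intro upd_sub) auto
    \<comment> \<open>An update of entry 0 passes through right multiplication by \<open>a\<close>,
      which is linear; an update elsewhere commutes with the change at 0.\<close>
    have eq: "h0 a F (n, \<beta>(i := x)) = (if i = 0 then F (n, \<beta>(0 := x \<otimes>\<^bsub>M\<^esub> a))
        else F (n, (\<beta>(0 := \<beta> 0 \<otimes>\<^bsub>M\<^esub> a))(i := x)))" if "x \<in> carrier M" for x
      using upd_sub[OF \<beta> that, of i] by (simp add: h0_def fun_upd_twist)
    show "h0 a F (n, \<beta>(i := x \<oplus>\<^bsub>M\<^esub> w)) = h0 a F (n, \<beta>(i := x)) \<oplus> h0 a F (n, \<beta>(i := w))"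
      if w: "w \<in> carrier M" for w
      using FD(3)[OF \<beta>' x w] FD(3)[OF \<beta>, of "x \<otimes>\<^bsub>M\<^esub> a" "w \<otimes>\<^bsub>M\<^esub> a"] x w a
      by (simp add: eq l_distr)
    show "h0 a F (n, \<beta>(i := c \<odot>\<^bsub>M\<^esub> x)) = c \<otimes> h0 a F (n, \<beta>(i := x))"
      if c: "c \<in> carrier R" for c
      using FD(4)[OF \<beta>' c x] FD(4)[OF \<beta> c, of "x \<otimes>\<^bsub>M\<^esub> a"] x c a
      by (simp add: eq smult_mult_left)
  qed
  have cons_sub: "range (case_nat \<one>\<^bsub>M\<^esub> \<beta>) \<subseteq> carrier M" if "range \<beta> \<subseteq> carrier M"
    for \<beta> :: "nat \<Rightarrow> 'a"
    using that by (auto simp: image_subset_iff split: nat.split)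
  \<comment> \<open>Prefixing 1 moves entry \<open>i\<close> to place \<open>Suc i\<close>, so
    \<open>y0 F\<close> inherits linearity in entry \<open>i\<close> from \<open>F\<close> at that
    place.\<close>
  have cons_upd: "case_nat \<one>\<^bsub>M\<^esub> (\<beta>(i := x)) = (case_nat \<one>\<^bsub>M\<^esub> \<beta>)(Suc i := x)"
    for \<beta> :: "nat \<Rightarrow> 'a" and i x
    by (auto simp: fun_eq_iff split: nat.split)
  have y0: "y0 F \<in> carrier V" if F: "F \<in> carrier V" for F
  proof (rule multilinear_sequencesI)
    note FD = multilinear_sequencesD[OF F]
    show "y0 F (n, \<beta>) \<in> carrier R" for n \<beta> by (simp add: y0_def FD)
    show "y0 F (n, \<beta>) = \<zero>" if "\<not> range \<beta> \<subseteq> carrier M" for n \<beta> using that by (simp add: y0_def)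
    fix n i x and \<beta> :: "nat \<Rightarrow> 'a" assume \<beta>: "range \<beta> \<subseteq> carrier M" and x: "x \<in> carrier M"
    have eq: "y0 F (n, \<beta>(i := x)) = F (n, (case_nat \<one>\<^bsub>M\<^esub> \<beta>)(Suc i := x))" if "x \<in> carrier M" for x
      using upd_sub[OF \<beta> that, of i] by (simp add: y0_def cons_upd)
    show "y0 F (n, \<beta>(i := x \<oplus>\<^bsub>M\<^esub> w)) = y0 F (n, \<beta>(i := x)) \<oplus> y0 F (n, \<beta>(i := w))"
      if w: "w \<in> carrier M" for w
      using x w by (simp add: eq FD(3)[OF cons_sub[OF \<beta>] x w])
    show "y0 F (n, \<beta>(i := c \<odot>\<^bsub>M\<^esub> x)) = c \<otimes> y0 F (n, \<beta>(i := x))"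
      if c: "c \<in> carrier R" for c
      using x c by (simp add: eq FD(4)[OF cons_sub[OF \<beta>] c x])
  qed
  have tail_sub: "range (\<beta> \<circ> Suc) \<subseteq> carrier M" if "range \<beta> \<subseteq> carrier M" for \<beta> :: "nat \<Rightarrow> 'a"
    using that by (auto simp: image_subset_iff)
  have tail_upd: "(\<beta>(0 := x)) \<circ> Suc = \<beta> \<circ> Suc" "(\<beta>(Suc i := x)) \<circ> Suc = (\<beta> \<circ> Suc)(i := x)"
    for \<beta> :: "nat \<Rightarrow> 'a" and i x
    by (auto simp: fun_eq_iff)
  have z0: "z0 \<phi> F \<in> carrier V" if F: "F \<in> carrier V" and \<phi>: "\<phi> \<in> carrier M \<rightarrow> carrier R"
    "\<And>x y. \<lbrakk>x \<in> carrier M; y \<in> carrier M\<rbrakk> \<Longrightarrow> \<phi> (x \<oplus>\<^bsub>M\<^esub> y) = \<phi> x \<oplus> \<phi> y"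
    "\<And>c x. \<lbrakk>c \<in> carrier R; x \<in> carrier M\<rbrakk> \<Longrightarrow> \<phi> (c \<odot>\<^bsub>M\<^esub> x) = c \<otimes> \<phi> x" for \<phi> F
  proof (rule multilinear_sequencesI)
    note FD = multilinear_sequencesD[OF F]
    have \<phi>_closed: "\<phi> x \<in> carrier R" if "x \<in> carrier M" for x using that \<phi>(1) by auto
    show "z0 \<phi> F (n, \<beta>) \<in> carrier R" for n \<beta>
      using FD(1) by (auto simp: z0_def image_subset_iff \<phi>_closed)
    show "z0 \<phi> F (n, \<beta>) = \<zero>" if "\<not> range \<beta> \<subseteq> carrier M" for n \<beta> using that by (simp add: z0_def)
    fix n i x and \<beta> :: "nat \<Rightarrow> 'a" assume \<beta>: "range \<beta> \<subseteq> carrier M" and x: "x \<in> carrier M"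
    have b0: "\<phi> (\<beta> 0) \<in> carrier R" using \<beta> \<phi>_closed by auto
    \<comment> \<open>Entry 0 is handled by the linearity of \<open>\<phi>\<close>, and each later
      entry by the linearity of \<open>F\<close> one place down.\<close>
    have eq0: "z0 \<phi> F (n, \<beta>(0 := x)) = \<phi> x \<otimes> F (n, \<beta> \<circ> Suc)" if "x \<in> carrier M" for x
      using upd_sub[OF \<beta> that, of 0] by (simp add: z0_def tail_upd)
    have eqS: "z0 \<phi> F (n, \<beta>(Suc j := x)) = \<phi> (\<beta> 0) \<otimes> F (n, (\<beta> \<circ> Suc)(j := x))"
      if "x \<in> carrier M" for x j
      using upd_sub[OF \<beta> that, of "Suc j"] by (simp add: z0_def tail_upd)
    show "z0 \<phi> F (n, \<beta>(i := x \<oplus>\<^bsub>M\<^esub> w)) = z0 \<phi> F (n, \<beta>(i := x)) \<oplus> z0 \<phi> F (n, \<beta>(i := w))"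
      if w: "w \<in> carrier M" for w
      using x w b0 FD(1)
      by (cases i) (simp_all add: eq0 eqS FD(3)[OF tail_sub[OF \<beta>] x w] \<phi>(2) \<phi>_closed
        R.l_distr R.r_distr)
    show "z0 \<phi> F (n, \<beta>(i := c \<odot>\<^bsub>M\<^esub> x)) = c \<otimes> z0 \<phi> F (n, \<beta>(i := x))"
      if c: "c \<in> carrier R" for c
      using x c b0 FD(1)
      by (cases i) (simp_all add: eq0 eqS FD(4)[OF tail_sub[OF \<beta>] c x] \<phi>(3) \<phi>_closed
        R.m_assoc R.m_lcomm)
  qed
  have hE: "h a \<in> carrier E" if "a \<in> carrier M" for a
    unfolding h_def E_def
    by (rule V.extend_by_zero_endomorphism)
      (use that in \<open>auto simp: h0 simps\<close>, auto simp: h0_def fun_eq_iff)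
  have yE: "y \<in> carrier E"
    unfolding y_def E_def
    by (rule V.extend_by_zero_endomorphism) (auto simp: y0 simps, auto simp: y0_def fun_eq_iff)
  have h: "h a F = h0 a F" and y: "y F = y0 F" if "F \<in> carrier V" for a F
    using that by (simp_all add: h_def y_def extend_by_zero_def)
  have arg: "\<beta> 0 \<in> carrier M" if "range \<beta> \<subseteq> carrier M" for \<beta> :: "nat \<Rightarrow> 'a" using that by auto
  have hom: "h \<in> algebra_hom R M E"
  proof (rule algebra_homI)
    fix a b assume ab: "a \<in> carrier M" "b \<in> carrier M"
    show "h (a \<otimes>\<^bsub>M\<^esub> b) = h a \<otimes>\<^bsub>E\<^esub> h b"
    proof (rule eqI)
      fix F assume F: "F \<in> carrier V"
      \<comment> \<open>The outer operator changes the argument first, so entry 0 is multiplied on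
        the right by \<open>a\<close> and then by \<open>b\<close>: right multiplication on
        arguments is a left action on functions.\<close>
      have "h0 (a \<otimes>\<^bsub>M\<^esub> b) F (n, \<beta>) = h0 a (h0 b F) (n, \<beta>)" for n \<beta>
        using arg[of \<beta>] ab upd_sub[of \<beta> "\<beta> 0 \<otimes>\<^bsub>M\<^esub> a" 0] by (simp add: h0_def m_assoc)
      then show "h (a \<otimes>\<^bsub>M\<^esub> b) F = (h a \<otimes>\<^bsub>E\<^esub> h b) F"
        using F ab by (simp add: Esimps h h0 fun_eq_iff)
    qed (use ab hE in auto)
    show "h (a \<oplus>\<^bsub>M\<^esub> b) = h a \<oplus>\<^bsub>E\<^esub> h b"
    proof (rule eqI)
      fix F assume F: "F \<in> carrier V"
      have "h0 (a \<oplus>\<^bsub>M\<^esub> b) F (n, \<beta>) = h0 a F (n, \<beta>) \<oplus> h0 b F (n, \<beta>)" for n \<beta>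
        using arg[of \<beta>] ab multilinear_sequencesD(3)[OF F, of \<beta>]
        by (simp add: h0_def r_distr)
      then show "h (a \<oplus>\<^bsub>M\<^esub> b) F = (h a \<oplus>\<^bsub>E\<^esub> h b) F"
        using F by (simp add: Esimps simps h fun_eq_iff)
    qed (use ab hE in auto)
  next
    fix c a assume c: "c \<in> carrier R" and a: "a \<in> carrier M"
    show "h (c \<odot>\<^bsub>M\<^esub> a) = c \<odot>\<^bsub>E\<^esub> h a"
    proof (rule eqI)
      fix F assume F: "F \<in> carrier V"
      have "h0 (c \<odot>\<^bsub>M\<^esub> a) F (n, \<beta>) = c \<otimes> h0 a F (n, \<beta>)" for n \<beta>
        using arg[of \<beta>] a c multilinear_sequencesD(4)[OF F, of \<beta>]
        by (simp add: h0_def smult_mult_right)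
      then show "h (c \<odot>\<^bsub>M\<^esub> a) F = (c \<odot>\<^bsub>E\<^esub> h a) F"
        using F by (simp add: Esimps simps h fun_eq_iff)
    qed (use a c hE in auto)
  next
    show "h \<one>\<^bsub>M\<^esub> = \<one>\<^bsub>E\<^esub>"
    proof (rule eqI)
      fix F assume F: "F \<in> carrier V"
      have "h0 \<one>\<^bsub>M\<^esub> F (n, \<beta>) = F (n, \<beta>)" for n \<beta>
        using arg[of \<beta>] multilinear_sequencesD(2)[OF F, of \<beta>] by (simp add: h0_def)
      then show "h \<one>\<^bsub>M\<^esub> F = \<one>\<^bsub>E\<^esub> F"
        using F by (simp add: Esimps h fun_eq_iff)
    qed (use hE in auto)
  qed (rule hE)
  have "\<exists>z\<in>carrier E. y \<otimes>\<^bsub>E\<^esub> (h a \<otimes>\<^bsub>E\<^esub> z) = \<one>\<^bsub>E\<^esub>" if a: "a \<in> carrier M" "a \<noteq> \<zero>\<^bsub>M\<^esub>" for a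
  proof -
    obtain \<phi> where \<phi>: "\<phi> \<in> carrier M \<rightarrow> carrier R" "\<phi> a = \<one>"
      "\<And>x y. \<lbrakk>x \<in> carrier M; y \<in> carrier M\<rbrakk> \<Longrightarrow> \<phi> (x \<oplus>\<^bsub>M\<^esub> y) = \<phi> x \<oplus> \<phi> y"
      "\<And>c x. \<lbrakk>c \<in> carrier R; x \<in> carrier M\<rbrakk> \<Longrightarrow> \<phi> (c \<odot>\<^bsub>M\<^esub> x) = c \<otimes> \<phi> x"
      using exists_linear_functional[OF assms(1) module_axioms a] by blast
    note z0\<phi> = z0[OF _ \<phi>(1,3,4)]
    define z where "z = extend_by_zero V (z0 \<phi>)"
    have \<phi>_closed: "\<phi> (\<beta> 0) \<in> carrier R" if "range \<beta> \<subseteq> carrier M" for \<beta> :: "nat \<Rightarrow> 'a"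
      using that \<phi>(1) by auto
    have zE: "z \<in> carrier E"
      unfolding z_def E_def
      by (rule V.extend_by_zero_endomorphism)
        (auto simp: z0\<phi> simps, auto simp: z0_def fun_eq_iff \<phi>_closed multilinear_sequencesD(1)
          R.r_distr R.m_lcomm)
    have "y \<otimes>\<^bsub>E\<^esub> (h a \<otimes>\<^bsub>E\<^esub> z) = \<one>\<^bsub>E\<^esub>"
    proof (rule eqI)
      fix F assume F: "F \<in> carrier V"
      have "y0 (h0 a (z0 \<phi> F)) (n, \<beta>) = F (n, \<beta>)" for n \<beta>
      proof (cases "range \<beta> \<subseteq> carrier M")
        case True
        have "(case_nat \<one>\<^bsub>M\<^esub> \<beta>)(0 := a) \<circ> Suc = \<beta>" by (auto simp: fun_eq_iff)
        then show ?thesis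
          using True cons_sub[OF True] upd_sub[OF cons_sub[OF True] a(1), of 0] a(1)
            multilinear_sequencesD(1)[OF F]
          by (simp add: y0_def h0_def z0_def \<phi>(2))
      next
        case False
        then show ?thesis using multilinear_sequencesD(2)[OF F] by (simp add: y0_def)
      qed
      then have "y0 (h0 a (z0 \<phi> F)) = F" by (simp add: fun_eq_iff)
      moreover have "z F = z0 \<phi> F" using F by (simp add: z_def extend_by_zero_def)
      ultimately show "(y \<otimes>\<^bsub>E\<^esub> (h a \<otimes>\<^bsub>E\<^esub> z)) F = \<one>\<^bsub>E\<^esub> F"
        using F a by (simp add: Esimps h h0 y z0\<phi>)
    qed (use a hE yE zE in auto)
    then show ?thesis using zE by blast
  qed
  then obtain z where "\<And>a. \<lbrakk>a \<in> carrier M; a \<noteq> \<zero>\<^bsub>M\<^esub>\<rbrakk> \<Longrightarrow>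
      z a \<in> carrier E \<and> y \<otimes>\<^bsub>E\<^esub> (h a \<otimes>\<^bsub>E\<^esub> z a) = \<one>\<^bsub>E\<^esub>"
    by metis
  then show ?thesis using that hom yE by blast
qed

end

section \<open>Construction of the simple algebra\<close>

theorem theorem3p4:
  fixes K :: "('k, 'm) ring_scheme" and A :: "('k, 'a, 'n) module_scheme"
  assumes "field K" and "countable (carrier K)"
    and "assoc_algebra K A" and "countably_generated_algebra K A"
    and "\<one>\<^bsub>A\<^esub> \<noteq> \<zero>\<^bsub>A\<^esub>"
  shows "\<exists>(B :: ('k, nat) module) h.
    simple_algebra K B \<and>
    (\<exists>a\<in>carrier B. \<exists>b\<in>carrier B. algebra_generated K B {a, b} = carrier B) \<and>
    h \<in> algebra_hom K A B \<and> inj_on h (carrier A)"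
proof -
  interpret K: field K by fact
  interpret A: assoc_algebra K A by fact
  define V where "V = multilinear_sequences K A"
  define E where "E = endomorphism_algebra K V"
  interpret V: module K V unfolding V_def by (rule K.multilinear_sequences)
  interpret E: assoc_algebra K E unfolding E_def by (rule V.endomorphism_algebra)
  have cntA: "countable (carrier A)"
    using assms(2,4) A.countable_algebra_generated unfolding countably_generated_algebra_def by metis
  obtain h y z where h: "h \<in> algebra_hom K A E" and y: "y \<in> carrier E"
    and z: "\<And>a. \<lbrakk>a \<in> carrier A; a \<noteq> \<zero>\<^bsub>A\<^esub>\<rbrakk> \<Longrightarrow>
      z a \<in> carrier E \<and> y \<otimes>\<^bsub>E\<^esub> (h a \<otimes>\<^bsub>E\<^esub> z a) = \<one>\<^bsub>E\<^esub>"
    unfolding E_def V_def using A.exists_action_with_one_sided_inverses[OF assms(1)] by metis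
  \<comment> \<open>These operators suffice to recover 1 from any \<open>h a\<close> with
    \<open>a\<close> nonzero. The set is countable because \<open>A\<close> is, and nonempty because
    of \<open>y\<close>, so some sequence enumerates it.\<close>
  define C where "C = insert y (h ` carrier A \<union> z ` (carrier A - {\<zero>\<^bsub>A\<^esub>}))"
  have CE: "C \<subseteq> carrier E"
    using y z algebra_homD(1)[OF h] by (auto simp: C_def)
  have C: "countable C" "C \<noteq> {}" using cntA by (auto simp: C_def)
  define c where "c = from_nat_into C"
  have c: "range c = C" unfolding c_def by (rule range_from_nat_into[OF C(2,1)])
  then have "c n \<in> carrier E" for n using CE by auto
  then obtain a b where ab: "a \<in> carrier E" "b \<in> carrier E" "C \<subseteq> algebra_generated K E {a, b}"
    unfolding c[symmetric] E_def V_def by (rule K.sequence_in_two_generated_algebra)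
  define H where "H = algebra_generated K E {a, b}"
  have H: "unital_subalgebra H K E"
    unfolding H_def using ab by (intro E.algebra_generated_subalgebra) auto
  have HE: "H \<subseteq> carrier E" using E.unital_subalgebraE(1)[OF H] .
  have CH: "C \<subseteq> H" using ab by (simp add: H_def)
  have abH: "{a, b} \<subseteq> H" unfolding H_def by (rule algebra_generated_incl)
  define M where "M = E\<lparr>carrier := H\<rparr>"
  have M_simps: "carrier M = H" "monoid.mult M = monoid.mult E" "ring.add M = ring.add E"
    "\<one>\<^bsub>M\<^esub> = \<one>\<^bsub>E\<^esub>" "\<zero>\<^bsub>M\<^esub> = \<zero>\<^bsub>E\<^esub>" "smult M = smult E"
    by (simp_all add: M_def)
  interpret M: assoc_algebra K M
    unfolding M_def by (rule E.unital_subalgebra_is_algebra[OF H])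
  \<comment> \<open>Countability of the two-generated algebra allows its quotient to be realised on
    the natural numbers.\<close>
  have cntM: "countable (carrier M)"
    unfolding M_simps H_def using ab assms(2) by (intro E.countable_algebra_generated) auto
  \<comment> \<open>Generation inside \<open>M\<close> agrees with generation inside
    \<open>E\<close>, since a subalgebra of the subalgebra \<open>H\<close> is a subalgebra of
    \<open>E\<close>.\<close>
  have genM: "algebra_generated K M {a, b} = carrier M"
  proof
    have *: "unital_subalgebra (algebra_generated K M {a, b}) K M"
      using abH by (intro M.algebra_generated_subalgebra) (simp add: M_simps)
    show "algebra_generated K M {a, b} \<subseteq> carrier M" using M.unital_subalgebraE(1)[OF *] .
    show "carrier M \<subseteq> algebra_generated K M {a, b}"
      unfolding M_simps(1) H_def
    proof (rule algebra_generated_least)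
      show "unital_subalgebra (algebra_generated K M {a, b}) K E"
        using E.unital_subalgebra_trans[OF H] * unfolding M_def by blast
    qed (rule algebra_generated_incl)
  qed
  \<comment> \<open>The space acted on is nonzero because \<open>A\<close> is, so its identity
    differs from the zero operator; this provides a maximal ideal of \<open>M\<close>.\<close>
  have "\<one>\<^bsub>M\<^esub> \<noteq> \<zero>\<^bsub>M\<^esub>"
  proof -
    obtain F where "F \<in> carrier V" "F \<noteq> \<zero>\<^bsub>V\<^esub>"
      using A.exists_nonzero_multilinear_sequence[OF assms(1,5)] unfolding V_def by blast
    then have "\<one>\<^bsub>E\<^esub> F \<noteq> \<zero>\<^bsub>E\<^esub> F" by (simp add: E_def endomorphism_algebra_simps)
    then show ?thesis unfolding M_simps by metis
  qed
  then obtain I where I: "maximalideal I M" using M.exists_maximalideal by blast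
  interpret I: maximalideal I M by (rule I)
  obtain B :: "('k, nat) module" and f where B: "assoc_algebra K B" and f: "f \<in> algebra_hom K M B"
    and surj: "f ` carrier M = carrier B"
    and ker: "\<And>x. x \<in> carrier M \<Longrightarrow> f x = \<zero>\<^bsub>B\<^esub> \<longleftrightarrow> x \<in> I"
    using M.countable_quotient[OF cntM I.is_ideal] by blast
  interpret B: assoc_algebra K B by (rule B)
  have simple: "simple_algebra K B"
    by (rule simple_algebra_quotient[OF M.assoc_algebra_axioms B f surj ker I])
  have abM: "{a, b} \<subseteq> carrier M" using abH by (simp add: M_simps)
  have gen: "algebra_generated K B {f a, f b} = carrier B"
    using algebra_generated_image[OF M.assoc_algebra_axioms B f surj abM genM] by simp
  have hM: "h x \<in> carrier M" if "x \<in> carrier A" for x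
    using that CH by (auto simp: C_def M_simps)
  define g where "g = f \<circ> h"
  have g: "g \<in> algebra_hom K A B"
    unfolding g_def using algebra_homD[OF h] algebra_homD[OF f, unfolded M_simps(2-)] hM
    by (intro algebra_homI) (simp_all add: M_simps)
  \<comment> \<open>If \<open>g\<close> identified two distinct elements, \<open>h ?v\<close> would
    lie in \<open>I\<close> for their difference \<open>?v\<close>. Multiplying by \<open>y\<close>
    and \<open>z ?v\<close>, which also lie in \<open>M\<close>, would put 1 into the proper ideal
    \<open>I\<close>.\<close>
  have "x = w" if xw: "x \<in> carrier A" "w \<in> carrier A" "g x = g w" for x w
  proof (rule ccontr)
    assume "x \<noteq> w"
    let ?v = "x \<ominus>\<^bsub>A\<^esub> w"
    have v: "?v \<in> carrier A" "?v \<noteq> \<zero>\<^bsub>A\<^esub>" using xw \<open>x \<noteq> w\<close> by auto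
    have "g ?v \<oplus>\<^bsub>B\<^esub> g w = g (?v \<oplus>\<^bsub>A\<^esub> w)" using v xw algebra_homD(2)[OF g] by simp
    also have "?v \<oplus>\<^bsub>A\<^esub> w = x" using xw by (simp add: A.M.minus_eq A.M.a_assoc A.M.l_neg)
    finally have "g ?v \<oplus>\<^bsub>B\<^esub> g w = g w" using xw by simp
    then have "g ?v = \<zero>\<^bsub>B\<^esub>"
      using algebra_homD(1)[OF g] v xw by (metis B.M.add.r_cancel_one)
    then have "h ?v \<in> I" using ker hM[OF v(1)] by (simp add: g_def)
    moreover have "y \<in> carrier M" "z ?v \<in> carrier M" using CH v by (auto simp: C_def M_simps)
    ultimately have "y \<otimes>\<^bsub>M\<^esub> (h ?v \<otimes>\<^bsub>M\<^esub> z ?v) \<in> I"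
      by (intro I.I_l_closed I.I_r_closed)
    then have "\<one>\<^bsub>M\<^esub> \<in> I" using z[OF v] by (simp add: M_simps)
    then show False using I.one_imp_carrier I.I_notcarr by blast
  qed
  then have "inj_on g (carrier A)" by (auto simp: inj_on_def)
  moreover have "f a \<in> carrier B" "f b \<in> carrier B" using abM surj by auto
  ultimately show ?thesis using simple gen g by blast
qed

end
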